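(* Let $0\leq\alpha<1$ and let $\psi \in L^2(\mathbb{R}) \setminus \{ 0 \}$ be such that $\hat{\psi}$ is continuous and, for some constant $C>0$, $$|\hat{\psi}(\xi)| \leq C (1+|\xi|)^{-r}\quad\text{for all } \xi \in \mathbb{R},$$ with $$r > \max\left\{ 1, \frac{\alpha}{2(1-\alpha)} \right\}.$$ Then $\psi$ is admissible (for the $\alpha$-modulation transform).
   Context: Fourier transform: $\hat f(\xi)=\int_{\mathbb{R}} f(x)e^{-2\pi i \xi x}\,dx$ (extended to $L^2(\mathbb{R})$). For $x,\omega\in\mathbb{R}$ and $a>0$ define the unitary operators on $L^2(\mathbb{R})$: $T_xf(t)=f(t-x)$, $M_\omega f(t)=e^{2\pi i\omega t}f(t)$, $D_af(t)=a^{-1/2}f(t/a)$. For $0\le\alpha<1$ let $\beta(\omega)=(1+|\omega|)^{-\alpha}$, and $\pi(\sigma(x,\omega))=T_xM_\omega D_{\beta(\omega)}$ for $(x,\omega)\in\mathbb{R}^2$ (Lebesgue measure on $\mathbb{R}^2$). For $\psi\in L^2(\mathbb{R})\setminus\{0\}$ define weakly $A_\sigma f=\int_{\mathbb{R}}\int_{\mathbb{R}}\langle f,\pi(\sigma(x,\omega))\psi\rangle\,\pi(\sigma(x,\omega))\psi\,dx\,d\omega$. The vector $\psi$ is called admissible if $A_\sigma$ is bounded and boundedly invertible on $L^2(\mathbb{R})$. It is known that $A_\sigma$ is the Fourier multiplier $\widehat{A_\sigma f}=m_\psi\hat f$ with symbol $$m_\psi(\xi)=\int_{\mathbb{R}}|\hat\psi(\beta(\omega)(\xi-\omega))|^2\beta(\omega)\,d\omega,$$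 so that admissibility of $\psi$ is equivalent to the existence of constants $A,B$ with $0<A\le m_\psi(\xi)\le B<\infty$ for almost all $\xi\in\mathbb{R}$. *)

theory Defs
  imports "HOL-Analysis.Analysis"
begin

text \<open>
  Elements of \<open>L\<^sup>2(\<real>)\<close> are represented by Borel measurable complex-valued functions, and
  equality of elements by equality almost everywhere.
\<close>

definition L2 :: "(real \<Rightarrow> complex) set" where
  "L2 = {f \<in> borel_measurable lborel. integrable lborel (\<lambda>t. (norm (f t))\<^sup>2)}"

definition L2_inner :: "(real \<Rightarrow> complex) \<Rightarrow> (real \<Rightarrow> complex) \<Rightarrow> complex" where
  "L2_inner f g = (LINT t|lborel. f t * cnj (g t))"

definition L2_norm :: "(real \<Rightarrow> complex) \<Rightarrow> real" where
  "L2_norm f = sqrt (LINT t|lborel. (norm (f t))\<^sup>2)"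

text \<open>
  Membership in \<open>L2\<close> is part of convergence, because \<open>L2_norm\<close> is \<open>0\<close> on functions
  that are not square integrable.
\<close>

definition L2_tendsto :: "(nat \<Rightarrow> real \<Rightarrow> complex) \<Rightarrow> (real \<Rightarrow> complex) \<Rightarrow> bool" where
  "L2_tendsto F f \<longleftrightarrow>
     (\<forall>n. F n \<in> L2) \<and> f \<in> L2 \<and> (\<lambda>n. L2_norm (\<lambda>t. F n t - f t)) \<longlonglongrightarrow> 0"

definition fourier :: "(real \<Rightarrow> complex) \<Rightarrow> real \<Rightarrow> complex" where
  "fourier f \<xi> = (LINT x|lborel. f x * exp (- 2 * pi * \<i> * \<xi> * x))"

text \<open>
  The extension by continuity of \<open>fourier\<close> from \<open>L\<^sup>1 \<inter> L\<^sup>2\<close> to \<open>L\<^sup>2\<close>, as a relation: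
  \<open>g\<close> is a representative of the transform of \<open>f\<close>. By Plancherel's theorem \<open>g\<close> exists,
  is unique up to null sets and does not depend on the approximating sequence.
\<close>

definition has_L2_fourier :: "(real \<Rightarrow> complex) \<Rightarrow> (real \<Rightarrow> complex) \<Rightarrow> bool" where
  "has_L2_fourier f g \<longleftrightarrow>
     (\<exists>F. (\<forall>n. integrable lborel (F n)) \<and> L2_tendsto F f \<and> L2_tendsto (\<lambda>n. fourier (F n)) g)"

definition translation :: "real \<Rightarrow> (real \<Rightarrow> complex) \<Rightarrow> real \<Rightarrow> complex" where
  "translation x f t = f (t - x)"

definition modulation :: "real \<Rightarrow> (real \<Rightarrow> complex) \<Rightarrow> real \<Rightarrow> complex" where
  "modulation \<omega> f t = exp (2 * pi * \<i> * \<omega> * t) * f t"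

definition dilation :: "real \<Rightarrow> (real \<Rightarrow> complex) \<Rightarrow> real \<Rightarrow> complex" where
  "dilation a f t = a powr (- 1 / 2) * f (t / a)"

definition alpha_scale :: "real \<Rightarrow> real \<Rightarrow> real" where
  "alpha_scale \<alpha> \<omega> = (1 + \<bar>\<omega>\<bar>) powr (- \<alpha>)"

definition alpha_atom ::
  "real \<Rightarrow> (real \<Rightarrow> complex) \<Rightarrow> real \<times> real \<Rightarrow> real \<Rightarrow> complex" where
  "alpha_atom \<alpha> \<psi> = (\<lambda>(x, \<omega>). translation x (modulation \<omega> (dilation (alpha_scale \<alpha> \<omega>) \<psi>)))"

definition L2_bounded_operator :: "((real \<Rightarrow> complex) \<Rightarrow> real \<Rightarrow> complex) \<Rightarrow> bool" where
  "L2_bounded_operator A \<longleftrightarrow>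
     (\<forall>f\<in>L2. A f \<in> L2) \<and>
     (\<forall>f\<in>L2. \<forall>g\<in>L2. AE t in lborel. A (\<lambda>s. f s + g s) t = A f t + A g t) \<and>
     (\<forall>c. \<forall>f\<in>L2. AE t in lborel. A (\<lambda>s. c * f s) t = c * A f t) \<and>
     (\<exists>K. \<forall>f\<in>L2. L2_norm (A f) \<le> K * L2_norm f)"

definition L2_boundedly_invertible :: "((real \<Rightarrow> complex) \<Rightarrow> real \<Rightarrow> complex) \<Rightarrow> bool" where
  "L2_boundedly_invertible A \<longleftrightarrow>
     (\<exists>B. L2_bounded_operator B \<and>
        (\<forall>f\<in>L2. AE t in lborel. B (A f) t = f t) \<and>
        (\<forall>f\<in>L2. AE t in lborel. A (B f) t = f t))"

text \<open>
  \<open>A\<close> is the operator defined weakly by \<open>A f = \<integral>\<integral> \<langle>f, \<pi>(\<sigma>(x,\<omega>))\<psi>\<rangle> \<pi>(\<sigma>(x,\<omega>))\<psi> dx d\<omega>\<close>.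
  The absolute convergence has to be required explicitly, since a Bochner integral is \<open>0\<close>
  when the integrand is not integrable.
\<close>

definition weak_frame_operator ::
  "real \<Rightarrow> (real \<Rightarrow> complex) \<Rightarrow> ((real \<Rightarrow> complex) \<Rightarrow> real \<Rightarrow> complex) \<Rightarrow> bool" where
  "weak_frame_operator \<alpha> \<psi> A \<longleftrightarrow>
     (\<forall>f\<in>L2. \<forall>g\<in>L2.
        integrable (lborel :: (real \<times> real) measure)
          (\<lambda>p. L2_inner f (alpha_atom \<alpha> \<psi> p) * L2_inner (alpha_atom \<alpha> \<psi> p) g) \<and>
        L2_inner (A f) g =
          (LINT p|(lborel :: (real \<times> real) measure).
             L2_inner f (alpha_atom \<alpha> \<psi> p) * L2_inner (alpha_atom \<alpha> \<psi> p) g))"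

definition admissible :: "real \<Rightarrow> (real \<Rightarrow> complex) \<Rightarrow> bool" where
  "admissible \<alpha> \<psi> \<longleftrightarrow>
     (\<exists>A. weak_frame_operator \<alpha> \<psi> A \<and> L2_bounded_operator A \<and> L2_boundedly_invertible A)"

end

theory Submission
  imports Defs "HOL-Probability.Characteristic_Functions"
begin

text \<open>
  The Plancherel theorem is built from the Gaussian: for integrable \<open>f\<close>, weighting
  \<open>\<bar>f_hat\<bar>\<^sup>2\<close> with a Gaussian gives the inner product of \<open>f\<close> with a Gaussian average of its
  translates. Letting the weight tend to \<open>1\<close> yields a contraction on the square integrable
  functions and an isometry on continuous functions of compact support, which are dense.

  For fixed \<open>\<omega>\<close>, integrating over \<open>x\<close> by Plancherel and then over \<open>\<omega>\<close> by Fubini shows that the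
  weakly defined operator is the Fourier multiplier with symbol \<open>m\<close>; it is invertible once
  \<open>m\<close> is bounded above and away from \<open>0\<close>. For the upper bound one compares \<open>\<omega>\<close> near \<open>\<xi>\<close>,
  where \<open>\<beta>(\<omega>)\<close> and \<open>\<beta>(\<xi>)\<close> are of the same order, with \<open>\<omega>\<close> far from \<open>\<xi>\<close>, where
  \<open>\<bar>\<xi> - \<omega>\<bar>\<close> dominates \<open>1 + \<bar>\<omega>\<bar>\<close>. For the lower bound, the map
  \<open>\<omega> \<mapsto> \<beta>(\<omega>)(\<xi> - \<omega>)\<close> takes a value where \<open>\<psi>_hat\<close> does not vanish, and stays near that value
  on an interval of length comparable to \<open>1/\<beta>\<close>.
\<close>

section \<open>Square integrable functions\<close>

text \<open>The relation \<open>has_L2_fourier\<close> carries neither existence nor uniqueness, and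
  every later step needs both, as well as surjectivity to turn a symbol into an operator; hence the
  work on completeness and density. The Gaussian is a good weight because its transform is explicit
  and is a probability density. The same obstacle returns on the plane, where absolute convergence
  is part of the claim: it is settled by Tonelli for \<open>f = g\<close> before any complex
  integral is exchanged. Since continuity and decay of \<open>\<psi>_hat\<close> hold at every
  point, so do the bounds for the symbol, and its reciprocal is again a bounded symbol. Both bounds
  are uniform in \<xi> for one reason: the weight \<beta> in the symbol is cancelled by the length
  1/\<beta> of the frequency range on which it acts.\<close>

lemma borel_measurable_cnj [measurable]: "cnj \<in> borel_measurable borel"
  by (intro borel_measurable_continuous_onI continuous_intros)

lemma L2_measurable: "f \<in> L2 \<Longrightarrow> f \<in> borel_measurable borel"
  by (simp add: L2_def)

lemma L2_integrable_sq: "f \<in> L2 \<Longrightarrow> integrable lborel (\<lambda>t. (norm (f t))\<^sup>2)"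
  by (simp add: L2_def)

lemma L2I:
  "f \<in> borel_measurable borel \<Longrightarrow> integrable lborel (\<lambda>t. (norm (f t))\<^sup>2) \<Longrightarrow> f \<in> L2"
  by (simp add: L2_def)

lemma L2_dominated:
  assumes "f \<in> L2" "g \<in> borel_measurable borel" "AE t in lborel. norm (g t) \<le> K * norm (f t)"
  shows "g \<in> L2"
proof (rule L2I[OF assms(2)])
  show "integrable lborel (\<lambda>t. (norm (g t))\<^sup>2)"
  proof (rule Bochner_Integration.integrable_bound)
    show "integrable lborel (\<lambda>t. K\<^sup>2 * (norm (f t))\<^sup>2)"
      using L2_integrable_sq[OF assms(1)] by simp
    show "(\<lambda>t. (norm (g t))\<^sup>2) \<in> borel_measurable lborel"
      using assms(2) by measurable
    show "AE t in lborel. norm ((norm (g t))\<^sup>2) \<le> norm (K\<^sup>2 * (norm (f t))\<^sup>2)"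
      using assms(3)
    proof eventually_elim
      case (elim t)
      have "(norm (g t))\<^sup>2 \<le> (K * norm (f t))\<^sup>2"
        using elim by (intro power_mono) auto
      then show ?case by (simp add: power_mult_distrib)
    qed
  qed
qed

lemma L2_cong_AE:
  assumes "f \<in> L2" "g \<in> borel_measurable borel" "AE t in lborel. f t = g t"
  shows "g \<in> L2"
  by (rule L2_dominated[OF assms(1,2), of 1]) (use assms(3) in auto)

lemma L2_add: assumes "f \<in> L2" "g \<in> L2" shows "(\<lambda>t. f t + g t) \<in> L2"
proof (rule L2I)
  note [measurable] = L2_measurable[OF assms(1)] L2_measurable[OF assms(2)]
  show "(\<lambda>t. f t + g t) \<in> borel_measurable borel" by measurable
  show "integrable lborel (\<lambda>t. (norm (f t + g t))\<^sup>2)"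
  proof (rule Bochner_Integration.integrable_bound)
    show "integrable lborel (\<lambda>t. 2 * (norm (f t))\<^sup>2 + 2 * (norm (g t))\<^sup>2)"
      using assms[THEN L2_integrable_sq] by simp
    show "AE t in lborel. norm ((norm (f t + g t))\<^sup>2) \<le> norm (2 * (norm (f t))\<^sup>2 + 2 * (norm (g t))\<^sup>2)"
    proof (rule AE_I2)
      fix t
      have "(norm (f t + g t))\<^sup>2 \<le> (norm (f t) + norm (g t))\<^sup>2"
        by (intro power_mono norm_triangle_ineq) auto
      also have "\<dots> \<le> 2 * (norm (f t))\<^sup>2 + 2 * (norm (g t))\<^sup>2"
        using sum_squares_bound[of "norm (f t)" "norm (g t)"] by (simp add: power2_sum)
      finally show "norm ((norm (f t + g t))\<^sup>2) \<le> norm (2 * (norm (f t))\<^sup>2 + 2 * (norm (g t))\<^sup>2)"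
        by simp
    qed
  qed measurable
qed

lemma L2_cmult: assumes "f \<in> L2" shows "(\<lambda>t. c * f t) \<in> L2"
  by (rule L2_dominated[OF assms, of _ "norm c"])
     (use L2_measurable[OF assms] in \<open>auto simp: norm_mult\<close>)

lemma L2_diff: assumes "f \<in> L2" "g \<in> L2" shows "(\<lambda>t. f t - g t) \<in> L2"
  using L2_add[OF assms(1) L2_cmult[OF assms(2), of "-1"]] by simp

lemma L2_cnj: "f \<in> L2 \<Longrightarrow> (\<lambda>t. cnj (f t)) \<in> L2"
  by (rule L2_dominated[of f _ 1]) (auto dest!: L2_measurable)

lemma L2_norm_sq: "(L2_norm f)\<^sup>2 = (LINT t|lborel. (norm (f t))\<^sup>2)"
  by (simp add: L2_norm_def)

lemma L2_norm_nonneg [simp]: "0 \<le> L2_norm f"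
  by (simp add: L2_norm_def)

lemma L2_norm_cnj [simp]: "L2_norm (\<lambda>t. cnj (f t)) = L2_norm f"
  by (simp add: L2_norm_def)

lemma L2_norm_cmult: "L2_norm (\<lambda>t. c * f t) = norm c * L2_norm f"
  by (simp add: L2_norm_def norm_mult power_mult_distrib real_sqrt_mult)

lemma L2_norm_minus_commute: "L2_norm (\<lambda>t. f t - g t) = L2_norm (\<lambda>t. g t - f t)"
  by (simp add: L2_norm_def norm_minus_commute)

lemma L2_norm_cong_AE:
  assumes "f \<in> borel_measurable borel" "g \<in> borel_measurable borel" "AE t in lborel. f t = g t"
  shows "L2_norm f = L2_norm g"
proof -
  note [measurable] = assms(1,2)
  have "(LINT t|lborel. (norm (f t))\<^sup>2) = (LINT t|lborel. (norm (g t))\<^sup>2)"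
    by (rule integral_cong_AE) (use assms(3) in \<open>auto elim: eventually_mono\<close>)
  then show ?thesis by (simp add: L2_norm_def)
qed

lemma L2_norm_mono_AE:
  assumes "f \<in> L2" "g \<in> L2" "AE t in lborel. norm (g t) \<le> K * norm (f t)" "K \<ge> 0"
  shows "L2_norm g \<le> K * L2_norm f"
proof -
  have "(LINT t|lborel. (norm (g t))\<^sup>2) \<le> (LINT t|lborel. K\<^sup>2 * (norm (f t))\<^sup>2)"
  proof (rule integral_mono_AE)
    show "AE t in lborel. (norm (g t))\<^sup>2 \<le> K\<^sup>2 * (norm (f t))\<^sup>2"
      using assms(3)
    proof eventually_elim
      case (elim t)
      then have "(norm (g t))\<^sup>2 \<le> (K * norm (f t))\<^sup>2" by (intro power_mono) auto
      then show ?case by (simp add: power_mult_distrib)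
    qed
  qed (use assms in \<open>auto intro: L2_integrable_sq\<close>)
  then have "(L2_norm g)\<^sup>2 \<le> (K * L2_norm f)\<^sup>2"
    by (simp add: L2_norm_sq power_mult_distrib)
  then show ?thesis by (rule power2_le_imp_le) (use assms in simp)
qed

lemma L2_norm_eq_0_AE:
  assumes "f \<in> L2" "L2_norm f = 0" shows "AE t in lborel. f t = 0"
proof -
  have "(LINT t|lborel. (norm (f t))\<^sup>2) = 0" using assms(2) by (simp add: L2_norm_def)
  then have "AE t in lborel. (norm (f t))\<^sup>2 = 0"
    by (subst (asm) integral_nonneg_eq_0_iff_AE) (use L2_integrable_sq[OF assms(1)] in auto)
  then show ?thesis by simp
qed

lemma L2_mult_integrable_norm:
  assumes "f \<in> L2" "g \<in> L2" shows "integrable lborel (\<lambda>t. norm (f t) * norm (g t))"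
proof (rule Bochner_Integration.integrable_bound)
  note [measurable] = L2_measurable[OF assms(1)] L2_measurable[OF assms(2)]
  show "integrable lborel (\<lambda>t. (norm (f t))\<^sup>2 + (norm (g t))\<^sup>2)"
    using assms[THEN L2_integrable_sq] by simp
  show "(\<lambda>t. norm (f t) * norm (g t)) \<in> borel_measurable lborel" by measurable
  have "norm (f t) * norm (g t) \<le> (norm (f t))\<^sup>2 + (norm (g t))\<^sup>2" for t
  proof -
    have "0 \<le> norm (f t) * norm (g t)" by simp
    moreover have "2 * (norm (f t) * norm (g t)) \<le> (norm (f t))\<^sup>2 + (norm (g t))\<^sup>2"
      using sum_squares_bound[of "norm (f t)" "norm (g t)"] by (simp add: mult.assoc)
    ultimately show ?thesis by linarith
  qed
  then show "AE t in lborel. norm (norm (f t) * norm (g t)) \<le> norm ((norm (f t))\<^sup>2 + (norm (g t))\<^sup>2)"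
    by simp
qed

lemma L2_mult_integrable:
  assumes "f \<in> L2" "g \<in> L2" shows "integrable lborel (\<lambda>t. f t * g t)"
proof (rule Bochner_Integration.integrable_bound[OF L2_mult_integrable_norm[OF assms]])
  note [measurable] = L2_measurable[OF assms(1)] L2_measurable[OF assms(2)]
  show "(\<lambda>t. f t * g t) \<in> borel_measurable lborel" by measurable
qed (simp add: norm_mult)

lemma L2_inner_integrable:
  assumes "f \<in> L2" "g \<in> L2" shows "integrable lborel (\<lambda>t. f t * cnj (g t))"
  by (rule L2_mult_integrable[OF assms(1) L2_cnj[OF assms(2)]])

text \<open>Passing to nonnegative extended integrals gives access to
  \<open>Cauchy_Schwarz_nn_integral\<close>. The norms stay inside the integral because the triangle
  inequality needs this stronger form.\<close>

lemma L2_cauchy_schwarz_norm: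
  assumes "f \<in> L2" "g \<in> L2"
  shows "(LINT t|lborel. norm (f t) * norm (g t)) \<le> L2_norm f * L2_norm g"
proof -
  note [measurable] = L2_measurable[OF assms(1)] L2_measurable[OF assms(2)]
  let ?I = "LINT t|lborel. norm (f t) * norm (g t)"
  have sq: "(\<integral>\<^sup>+t. (ennreal (norm (h t)))\<^sup>2 \<partial>lborel) = ennreal ((L2_norm h)\<^sup>2)" if "h \<in> L2" for h
    by (subst L2_norm_sq, subst nn_integral_eq_integral[symmetric])
       (use L2_integrable_sq[OF that] in \<open>auto simp: ennreal_power\<close>)
  have "ennreal ?I = (\<integral>\<^sup>+t. ennreal (norm (f t)) * ennreal (norm (g t)) \<partial>lborel)"
    by (subst nn_integral_eq_integral[symmetric])
       (use L2_mult_integrable_norm[OF assms] in \<open>auto simp: ennreal_mult\<close>)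
  then have "ennreal (?I\<^sup>2) = (\<integral>\<^sup>+t. ennreal (norm (f t)) * ennreal (norm (g t)) \<partial>lborel)\<^sup>2"
    by (simp flip: ennreal_power)
  also have "\<dots> \<le> (\<integral>\<^sup>+t. (ennreal (norm (f t)))\<^sup>2 \<partial>lborel) * (\<integral>\<^sup>+t. (ennreal (norm (g t)))\<^sup>2 \<partial>lborel)"
    by (rule Cauchy_Schwarz_nn_integral) measurable
  also have "\<dots> = ennreal ((L2_norm f * L2_norm g)\<^sup>2)"
    by (simp add: sq assms power_mult_distrib ennreal_mult)
  finally have "?I\<^sup>2 \<le> (L2_norm f * L2_norm g)\<^sup>2"
    by (subst (asm) ennreal_le_iff) auto
  then show ?thesis by (rule power2_le_imp_le) simp
qed

lemma L2_cauchy_schwarz: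
  assumes "f \<in> L2" "g \<in> L2"
  shows "norm (L2_inner f g) \<le> L2_norm f * L2_norm g"
proof -
  have "norm (L2_inner f g) \<le> (LINT t|lborel. norm (f t * cnj (g t)))"
    unfolding L2_inner_def by (rule integral_norm_bound)
  also have "\<dots> = (LINT t|lborel. norm (f t) * norm (g t))" by (simp add: norm_mult)
  finally show ?thesis using L2_cauchy_schwarz_norm[OF assms] by simp
qed

lemma L2_norm_triangle:
  assumes "f \<in> L2" "g \<in> L2"
  shows "L2_norm (\<lambda>t. f t + g t) \<le> L2_norm f + L2_norm g"
proof -
  have i: "integrable lborel (\<lambda>t. (norm (f t))\<^sup>2 + (norm (g t))\<^sup>2 + 2 * (norm (f t) * norm (g t)))"
    using assms[THEN L2_integrable_sq] L2_mult_integrable_norm[OF assms] by simp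
  have "(L2_norm (\<lambda>t. f t + g t))\<^sup>2 \<le> (LINT t|lborel. (norm (f t))\<^sup>2 + (norm (g t))\<^sup>2 + 2 * (norm (f t) * norm (g t)))"
    unfolding L2_norm_sq
  proof (rule integral_mono[OF L2_integrable_sq[OF L2_add[OF assms]] i])
    fix t
    have "(norm (f t + g t))\<^sup>2 \<le> (norm (f t) + norm (g t))\<^sup>2"
      by (intro power_mono norm_triangle_ineq) auto
    then show "(norm (f t + g t))\<^sup>2 \<le> (norm (f t))\<^sup>2 + (norm (g t))\<^sup>2 + 2 * (norm (f t) * norm (g t))"
      by (simp add: power2_sum)
  qed
  also have "\<dots> = (L2_norm f)\<^sup>2 + (L2_norm g)\<^sup>2 + 2 * (LINT t|lborel. norm (f t) * norm (g t))"
    using assms[THEN L2_integrable_sq] L2_mult_integrable_norm[OF assms] by (simp add: L2_norm_sq)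
  also have "\<dots> \<le> (L2_norm f + L2_norm g)\<^sup>2"
    using L2_cauchy_schwarz_norm[OF assms] by (simp add: power2_sum)
  finally show ?thesis by (rule power2_le_imp_le) simp
qed

lemma L2_norm_triangle_diff:
  assumes "f \<in> L2" "g \<in> L2" "h \<in> L2"
  shows "L2_norm (\<lambda>t. f t - h t) \<le> L2_norm (\<lambda>t. f t - g t) + L2_norm (\<lambda>t. g t - h t)"
  using L2_norm_triangle[OF L2_diff[OF assms(1,2)] L2_diff[OF assms(2,3)]] by simp

lemma L2_norm_diff_abs_le:
  assumes "f \<in> L2" "g \<in> L2"
  shows "\<bar>L2_norm f - L2_norm g\<bar> \<le> L2_norm (\<lambda>t. f t - g t)"
  using L2_norm_triangle[OF L2_diff[OF assms] assms(2)]
        L2_norm_triangle[OF L2_diff[OF assms(2,1)] assms(1)]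
  by (simp add: L2_norm_minus_commute[of g f])

section \<open>Convergence in norm and polarisation\<close>

lemma L2_tendstoD:
  assumes "L2_tendsto F f"
  shows "F n \<in> L2" "f \<in> L2" "(\<lambda>n. L2_norm (\<lambda>t. F n t - f t)) \<longlonglongrightarrow> 0"
  using assms by (auto simp: L2_tendsto_def)

lemma L2_tendsto_const: "f \<in> L2 \<Longrightarrow> L2_tendsto (\<lambda>n. f) f"
  by (simp add: L2_tendsto_def L2_norm_def)

lemma L2_tendsto_norm:
  assumes "L2_tendsto F f" shows "(\<lambda>n. L2_norm (F n)) \<longlonglongrightarrow> L2_norm f"
proof -
  have "(\<lambda>n. L2_norm (F n) - L2_norm f) \<longlonglongrightarrow> 0"
    by (rule Lim_null_comparison[OF _ L2_tendstoD(3)[OF assms]])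
       (use L2_norm_diff_abs_le L2_tendstoD[OF assms] in auto)
  then show ?thesis by (simp add: LIM_zero_iff)
qed

lemma L2_tendsto_add:
  assumes "L2_tendsto F f" "L2_tendsto G g"
  shows "L2_tendsto (\<lambda>n t. F n t + G n t) (\<lambda>t. f t + g t)"
proof -
  note F = L2_tendstoD[OF assms(1)] and G = L2_tendstoD[OF assms(2)]
  have "(\<lambda>n. L2_norm (\<lambda>t. (F n t + G n t) - (f t + g t))) \<longlonglongrightarrow> 0"
  proof (rule Lim_null_comparison)
    show "(\<lambda>n. L2_norm (\<lambda>t. F n t - f t) + L2_norm (\<lambda>t. G n t - g t)) \<longlonglongrightarrow> 0"
      using tendsto_add[OF F(3) G(3)] by simp
    show "\<forall>\<^sub>F n in sequentially. norm (L2_norm (\<lambda>t. (F n t + G n t) - (f t + g t)))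
        \<le> L2_norm (\<lambda>t. F n t - f t) + L2_norm (\<lambda>t. G n t - g t)"
      using L2_norm_triangle[OF L2_diff[OF F(1,2)] L2_diff[OF G(1,2)]]
      by (simp add: algebra_simps)
  qed
  then show ?thesis using F G by (auto simp: L2_tendsto_def intro: L2_add)
qed

lemma L2_tendsto_cmult:
  assumes "L2_tendsto F f" shows "L2_tendsto (\<lambda>n t. c * F n t) (\<lambda>t. c * f t)"
proof -
  note F = L2_tendstoD[OF assms]
  have "(\<lambda>n. norm c * L2_norm (\<lambda>t. F n t - f t)) \<longlonglongrightarrow> 0"
    using tendsto_mult_left[OF F(3), of "norm c"] by simp
  then have "(\<lambda>n. L2_norm (\<lambda>t. c * F n t - c * f t)) \<longlonglongrightarrow> 0"
    by (simp add: L2_norm_cmult flip: right_diff_distrib)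
  then show ?thesis using F by (auto simp: L2_tendsto_def intro: L2_cmult)
qed

lemma L2_tendsto_cnj:
  assumes "L2_tendsto F f" shows "L2_tendsto (\<lambda>n t. cnj (F n t)) (\<lambda>t. cnj (f t))"
  using L2_tendstoD[OF assms] L2_norm_cnj[of "\<lambda>t. F n t - f t" for n]
  by (auto simp: L2_tendsto_def intro: L2_cnj)

lemma L2_inner_diff:
  assumes "f \<in> L2" "f' \<in> L2" "g \<in> L2"
  shows "L2_inner (\<lambda>t. f t - f' t) g = L2_inner f g - L2_inner f' g"
    and "L2_inner g (\<lambda>t. f t - f' t) = L2_inner g f - L2_inner g f'"
  using L2_inner_integrable assms by (simp_all add: L2_inner_def algebra_simps)

lemma L2_tendsto_inner:
  assumes "L2_tendsto F f" "L2_tendsto G g"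
  shows "(\<lambda>n. L2_inner (F n) (G n)) \<longlonglongrightarrow> L2_inner f g"
proof -
  note F = L2_tendstoD[OF assms(1)] and G = L2_tendstoD[OF assms(2)]
  have "(\<lambda>n. L2_inner (F n) (G n) - L2_inner f g) \<longlonglongrightarrow> 0"
  proof (rule Lim_null_comparison)
    show "(\<lambda>n. L2_norm (\<lambda>t. F n t - f t) * L2_norm (G n) + L2_norm f * L2_norm (\<lambda>t. G n t - g t)) \<longlonglongrightarrow> 0"
      using tendsto_add[OF tendsto_mult[OF F(3) L2_tendsto_norm[OF assms(2)]] tendsto_mult_left[OF G(3), of "L2_norm f"]]
      by simp
    have "norm (L2_inner (F n) (G n) - L2_inner f g)
        \<le> L2_norm (\<lambda>t. F n t - f t) * L2_norm (G n) + L2_norm f * L2_norm (\<lambda>t. G n t - g t)" for n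
    proof -
      have "L2_inner (F n) (G n) - L2_inner f g
          = L2_inner (\<lambda>t. F n t - f t) (G n) + L2_inner f (\<lambda>t. G n t - g t)"
        using F G by (simp add: L2_inner_diff)
      then show ?thesis
        using norm_triangle_mono[OF L2_cauchy_schwarz[OF L2_diff[OF F(1,2)] G(1)]
            L2_cauchy_schwarz[OF F(2) L2_diff[OF G(1,2)]]] by simp
    qed
    then show "\<forall>\<^sub>F n in sequentially. norm (L2_inner (F n) (G n) - L2_inner f g)
        \<le> L2_norm (\<lambda>t. F n t - f t) * L2_norm (G n) + L2_norm f * L2_norm (\<lambda>t. G n t - g t)"
      by simp
  qed
  then show ?thesis by (simp add: LIM_zero_iff)
qed

text \<open>Serves polarisation, since norms determine the real part of the inner product. It also
  recognises \<open>f = g\<close> almost everywhere from equal norms and the largest possible inner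
  product.\<close>

lemma L2_norm_diff_sq:
  assumes "f \<in> L2" "g \<in> L2"
  shows "(L2_norm (\<lambda>t. f t - g t))\<^sup>2 = (L2_norm f)\<^sup>2 + (L2_norm g)\<^sup>2 - 2 * Re (L2_inner f g)"
proof -
  have re: "Re (L2_inner f g) = (LINT t|lborel. Re (f t * cnj (g t)))"
    unfolding L2_inner_def using integral_Re[OF L2_inner_integrable[OF assms]] by (rule sym)
  have i: "integrable lborel (\<lambda>t. Re (f t * cnj (g t)))"
    by (rule integrable_Re[OF L2_inner_integrable[OF assms]])
  have "(norm (f t - g t))\<^sup>2 = (norm (f t))\<^sup>2 + (norm (g t))\<^sup>2 - 2 * Re (f t * cnj (g t))" for t
    by (simp only: cmod_power2) (simp add: power2_eq_square algebra_simps)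
  then show ?thesis
    unfolding re L2_norm_sq
    using assms[THEN L2_integrable_sq] i by (simp del: times_complex.simps)
qed

lemma L2_inner_self: "L2_inner f f = (L2_norm f)\<^sup>2"
proof -
  have "L2_inner f f = (LINT t|lborel. complex_of_real ((norm (f t))\<^sup>2))"
    unfolding L2_inner_def
    by (intro Bochner_Integration.integral_cong refl) (metis complex_norm_square)
  also have "\<dots> = (L2_norm f)\<^sup>2" by (subst integral_complex_of_real) (simp add: L2_norm_sq)
  finally show ?thesis .
qed

text \<open>The majorant \<open>h\<close> also dominates the limit, so the squared difference has
  the integrable bound \<open>4 * (norm (h t))\<^sup>2\<close>.\<close>

lemma L2_tendsto_dominated:
  assumes "h \<in> L2" "\<And>n. F n \<in> borel_measurable borel" "f \<in> borel_measurable borel"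
    and lim: "AE t in lborel. (\<lambda>n. F n t) \<longlonglongrightarrow> f t"
    and bound: "\<And>n. AE t in lborel. norm (F n t) \<le> norm (h t)"
  shows "L2_tendsto F f"
proof -
  note [measurable] = assms(2,3) L2_measurable[OF assms(1)]
  have all: "AE t in lborel. \<forall>n. norm (F n t) \<le> norm (h t)"
    using bound by (simp add: AE_all_countable)
  have fb: "AE t in lborel. norm (f t) \<le> norm (h t)"
    using all lim
  proof eventually_elim
    case (elim t)
    then show ?case by (intro Lim_norm_ubound[OF _ elim(2)]) auto
  qed
  have "(\<lambda>n. LINT t|lborel. (norm (F n t - f t))\<^sup>2) \<longlonglongrightarrow> (LINT t|(lborel :: real measure). (0::real))"
  proof (rule integral_dominated_convergence)
    show "integrable lborel (\<lambda>t. 4 * (norm (h t))\<^sup>2)" using L2_integrable_sq[OF assms(1)] by simp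
    show "AE t in lborel. (\<lambda>n. (norm (F n t - f t))\<^sup>2) \<longlonglongrightarrow> 0"
      using lim
    proof eventually_elim
      case (elim t)
      then have "(\<lambda>n. norm (F n t - f t)) \<longlonglongrightarrow> 0"
        by (simp add: tendsto_norm_zero_iff LIM_zero_iff)
      from tendsto_power[OF this, of 2] show ?case by simp
    qed
    show "AE t in lborel. norm ((norm (F n t - f t))\<^sup>2) \<le> 4 * (norm (h t))\<^sup>2" for n
      using bound[of n] fb
    proof eventually_elim
      case (elim t)
      have "norm (F n t - f t) \<le> 2 * norm (h t)"
        using norm_triangle_ineq4[of "F n t" "f t"] elim by simp
      then have "(norm (F n t - f t))\<^sup>2 \<le> (2 * norm (h t))\<^sup>2" by (intro power_mono) auto
      then show ?case by (simp add: power_mult_distrib)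
    qed
  qed measurable
  then have "(\<lambda>n. L2_norm (\<lambda>t. F n t - f t)) \<longlonglongrightarrow> 0"
    unfolding L2_norm_def using tendsto_real_sqrt by fastforce
  moreover have "F n \<in> L2" for n
    by (rule L2_dominated[OF assms(1), of _ 1]) (use bound in auto)
  moreover have "f \<in> L2" by (rule L2_dominated[OF assms(1), of _ 1]) (use fb in auto)
  ultimately show ?thesis by (simp add: L2_tendsto_def)
qed

section \<open>Completeness\<close>

lemma geometric_increments_bound:
  fixes x :: "nat \<Rightarrow> 'a::real_normed_vector"
  assumes "\<And>n. norm (x (Suc n) - x n) \<le> c * (1/2)^n"
  shows "norm (x (N + k) - x N) \<le> 2 * c * (1/2)^N"
proof -
  \<comment> \<open>The exact partial geometric sum is carried through the induction, since the
    bound without the subtracted term does not reproduce itself.\<close>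
  have "norm (x (N + k) - x N) \<le> c * (1/2)^N * (2 - 2 * (1/2)^k)"
  proof (induction k)
    case (Suc k)
    have "norm (x (N + Suc k) - x N) \<le> norm (x (Suc (N + k)) - x (N + k)) + norm (x (N + k) - x N)"
      using norm_triangle_ineq[of "x (Suc (N + k)) - x (N + k)" "x (N + k) - x N"] by simp
    also have "\<dots> \<le> c * (1/2)^(N + k) + c * (1/2)^N * (2 - 2 * (1/2)^k)"
      using Suc assms by (intro add_mono)
    also have "\<dots> = c * (1/2)^N * (2 - 2 * (1/2)^(Suc k))"
      by (simp add: power_add algebra_simps)
    finally show ?case .
  qed simp
  also have "\<dots> \<le> c * (1/2)^N * 2"
  proof (rule mult_left_mono)
    show "0 \<le> c * (1/2)^N" using order_trans[OF norm_ge_zero assms] .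
  qed simp
  finally show ?thesis by (simp add: algebra_simps)
qed

text \<open>Riesz-Fischer for rapidly Cauchy sequences. Weighting the squared increments by
  \<open>4^n\<close> against their decay \<open>(1/8)^n\<close> leaves an integrable sum
  \<open>W\<close>, and \<open>W\<close> in turn forces pointwise increments of ratio 1/2. This one
  function yields both convergence almost everywhere and a majorant for the errors.\<close>

lemma L2_complete_fast:
  assumes G: "\<And>n. G n \<in> L2"
    and step: "\<And>n. (L2_norm (\<lambda>t. G (Suc n) t - G n t))\<^sup>2 \<le> K * (1/8)^n"
  shows "\<exists>g. L2_tendsto G g"
proof -
  have [measurable]: "G n \<in> borel_measurable borel" for n by (rule L2_measurable[OF G])
  define d where "d n t = 4^n * (norm (G (Suc n) t - G n t))\<^sup>2" for n t
  have [measurable]: "d n \<in> borel_measurable borel" for n unfolding d_def by measurable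
  have d_nn: "0 \<le> d n t" for n t by (simp add: d_def)
  define W where "W t = (\<Sum>n. d n t)" for t
  have [measurable]: "W \<in> borel_measurable borel" unfolding W_def by measurable
  have K: "0 \<le> K" using step[of 0] order_trans[OF zero_le_power2] by force
  have "(\<integral>\<^sup>+t. (\<Sum>n. ennreal (d n t)) \<partial>lborel) = (\<Sum>n. \<integral>\<^sup>+t. ennreal (d n t) \<partial>lborel)"
    by (rule nn_integral_suminf) measurable
  also have "\<dots> \<le> (\<Sum>n. ennreal (K * (1/2)^n))"
  proof (intro suminf_le)
    fix n
    have "(\<integral>\<^sup>+t. ennreal (d n t) \<partial>lborel) = ennreal (LINT t|lborel. d n t)"
      by (rule nn_integral_eq_integral)
         (use L2_integrable_sq[OF L2_diff[OF G G]] d_nn in \<open>auto simp: d_def\<close>)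
    also have "(LINT t|lborel. d n t) = 4^n * (L2_norm (\<lambda>t. G (Suc n) t - G n t))\<^sup>2"
      by (simp add: d_def L2_norm_sq)
    also have "\<dots> \<le> 4^n * (K * (1/8)^n)" by (intro mult_left_mono step) simp
    also have "\<dots> = K * (1/2)^n" by (simp add: power_divide power_mult_distrib[symmetric] field_simps)
    finally show "(\<integral>\<^sup>+t. ennreal (d n t) \<partial>lborel) \<le> ennreal (K * (1/2)^n)"
      by (simp add: ennreal_leI)
  qed auto
  also have "\<dots> = ennreal (\<Sum>n. K * (1/2)^n)"
    by (rule suminf_ennreal2) (use K in \<open>auto intro!: summable_mult summable_geometric\<close>)
  finally have fin: "(\<integral>\<^sup>+t. (\<Sum>n. ennreal (d n t)) \<partial>lborel) < \<infinity>"
    by (rule order.strict_trans1) simp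
  then have "AE t in lborel. (\<Sum>n. ennreal (d n t)) \<noteq> \<infinity>"
    by (intro nn_integral_PInf_AE) auto
  then have summ: "AE t in lborel. summable (\<lambda>n. d n t)"
    by eventually_elim (rule summable_suminf_not_top, auto simp: d_nn)
  have "AE t in lborel. (\<Sum>n. ennreal (d n t)) = ennreal (W t)"
    using summ by eventually_elim (simp add: W_def suminf_ennreal2 d_nn)
  then have "(\<integral>\<^sup>+t. ennreal (W t) \<partial>lborel) = (\<integral>\<^sup>+t. (\<Sum>n. ennreal (d n t)) \<partial>lborel)"
    by (intro nn_integral_cong_AE) (auto elim: eventually_mono)
  with fin have Wfin: "(\<integral>\<^sup>+t. ennreal (W t) \<partial>lborel) < \<infinity>" by simp
  have W_nn: "AE t in lborel. 0 \<le> W t"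
    using summ by eventually_elim (auto simp: W_def d_nn intro: suminf_nonneg)
  have Wint: "integrable lborel W"
    by (rule integrableI_nonneg) (use Wfin W_nn in auto)
  \<comment> \<open>\<open>lim\<close> has an unspecified value where the sequence diverges; this
    happens only on a null set, and \<open>g\<close> is measurable everywhere.\<close>
  define g where "g t = lim (\<lambda>n. G n t)" for t
  have [measurable]: "g \<in> borel_measurable borel" unfolding g_def by measurable
  have key: "AE t in lborel. \<forall>N. (norm (G N t - g t))\<^sup>2 \<le> 4 * W t * (1/4)^N"
    using summ W_nn
  proof eventually_elim
    case (elim t)
    have inc: "norm (G (Suc n) t - G n t) \<le> sqrt (W t) * (1/2)^n" for n
    proof (rule power2_le_imp_le)
      have "d n t \<le> W t"
        unfolding W_def using sum_le_suminf[OF elim(1), of "{n}"] d_nn by simp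
      then have "(norm (G (Suc n) t - G n t))\<^sup>2 \<le> W t / 4^n"
        by (simp add: d_def field_simps)
      also have "\<dots> = (sqrt (W t) * (1/2)^n)\<^sup>2"
        using elim(2) by (simp add: power_mult_distrib power_divide flip: power_mult)
           (simp add: power_mult mult.commute[of n])
      finally show "(norm (G (Suc n) t - G n t))\<^sup>2 \<le> (sqrt (W t) * (1/2)^n)\<^sup>2" .
    qed (use elim in simp)
    have tail: "norm (G (N + k) t - G N t) \<le> 2 * sqrt (W t) * (1/2)^N" for N k
      by (rule geometric_increments_bound[OF inc])
    have "summable (\<lambda>n. G (Suc n) t - G n t)"
      by (rule summable_comparison_test'[OF summable_mult[OF summable_geometric]])
         (use inc in auto)
    then have "convergent (\<lambda>n. G n t - G 0 t)"
      using sum_lessThan_telescope[of "\<lambda>n. G n t"] by (simp add: summable_iff_convergent)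
    then have "convergent (\<lambda>n. G n t)"
      by (simp add: convergent_diff_const_right_iff)
    then have lim: "(\<lambda>n. G n t) \<longlonglongrightarrow> g t"
      unfolding g_def by (simp add: convergent_LIMSEQ_iff)
    show ?case
    proof
      fix N
      have "(\<lambda>k. G (k + N) t - G N t) \<longlonglongrightarrow> g t - G N t"
        by (intro tendsto_intros LIMSEQ_ignore_initial_segment lim)
      then have "norm (g t - G N t) \<le> 2 * sqrt (W t) * (1/2)^N"
        by (rule Lim_norm_ubound[rotated]) (use tail[of N] in \<open>auto simp: add.commute\<close>)
      then have "(norm (G N t - g t))\<^sup>2 \<le> (2 * sqrt (W t) * (1/2)^N)\<^sup>2"
        by (subst norm_minus_commute) (intro power_mono, auto)
      also have "\<dots> = 4 * W t * (1/4)^N"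
        using elim(2) by (simp add: power_mult_distrib power_divide flip: power_mult)
           (simp add: power_mult mult.commute[of N])
      finally show "(norm (G N t - g t))\<^sup>2 \<le> 4 * W t * (1/4)^N" .
    qed
  qed
  have diff: "(\<lambda>t. G N t - g t) \<in> L2" for N
  proof (rule L2I)
    show "integrable lborel (\<lambda>t. (norm (G N t - g t))\<^sup>2)"
    proof (rule Bochner_Integration.integrable_bound)
      show "integrable lborel (\<lambda>t. 4 * W t * (1/4)^N)" using Wint by simp
      show "AE t in lborel. norm ((norm (G N t - g t))\<^sup>2) \<le> norm (4 * W t * (1/4)^N)"
        using key by eventually_elim (simp, metis abs_ge_self order_trans)
    qed measurable
  qed measurable
  \<comment> \<open>Only differences with \<open>g\<close> are controlled so far; subtracting one of
    them from \<open>G 0\<close> recovers \<open>g\<close> itself.\<close>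
  have "(\<lambda>t. G 0 t - (G 0 t - g t)) \<in> L2" by (rule L2_diff[OF G diff])
  then have "g \<in> L2" by simp
  moreover have "(\<lambda>N. L2_norm (\<lambda>t. G N t - g t)) \<longlonglongrightarrow> 0"
  proof -
    have "(LINT t|lborel. (norm (G N t - g t))\<^sup>2) \<le> (LINT t|lborel. 4 * W t * (1/4)^N)" for N
      by (rule integral_mono_AE)
         (use key Wint L2_integrable_sq[OF diff[of N]] in \<open>auto elim: eventually_mono\<close>)
    then have "(L2_norm (\<lambda>t. G N t - g t))\<^sup>2 \<le> 4 * (LINT t|lborel. W t) * (1/4)^N" for N
      by (simp add: L2_norm_sq)
    moreover have "(\<lambda>N. 4 * (LINT t|lborel. W t) * (1/4)^N) \<longlonglongrightarrow> 0"
      by (intro tendsto_mult_right_zero LIMSEQ_power_zero) simp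
    ultimately have "(\<lambda>N. (L2_norm (\<lambda>t. G N t - g t))\<^sup>2) \<longlonglongrightarrow> 0"
      by (intro Lim_null_comparison[of "\<lambda>N. (L2_norm (\<lambda>t. G N t - g t))\<^sup>2"]) auto
    from tendsto_real_sqrt[OF this] show ?thesis by simp
  qed
  ultimately show ?thesis using G by (auto simp: L2_tendsto_def)
qed

section \<open>Density of continuous functions of compact support\<close>

lemma bounded_support_L2_integrable:
  assumes "f \<in> borel_measurable borel" "\<And>t. norm (f t) \<le> M" "\<And>t. \<bar>t\<bar> > R \<Longrightarrow> f t = 0"
  shows "f \<in> L2" "integrable lborel f"
proof -
  note [measurable] = assms(1)
  have ind: "integrable lborel (\<lambda>t. c * indicator {-R..R} t :: real)" for c
    by (intro integrable_mult_right integrable_real_indicator) (auto simp: emeasure_lborel_Icc_eq)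
  have M: "0 \<le> M" using order_trans[OF norm_ge_zero assms(2)] .
  have b: "norm (f t) \<le> M * indicator {-R..R} t" for t
    using assms(2)[of t] assms(3)[of t] by (auto simp: indicator_def abs_le_iff not_le)
  show "integrable lborel f"
    by (rule Bochner_Integration.integrable_bound[OF ind[of M]])
       (use b in \<open>auto simp: order_trans[OF b abs_ge_self]\<close>)
  show "f \<in> L2"
  proof (rule L2I[OF assms(1)], rule Bochner_Integration.integrable_bound[OF ind[of "M\<^sup>2"]])
    have "(norm (f t))\<^sup>2 \<le> M\<^sup>2 * indicator {-R..R} t" for t
      using power_mono[OF b[of t], of 2] by (auto simp: indicator_def)
    then show "AE t in lborel. norm ((norm (f t))\<^sup>2) \<le> norm (M\<^sup>2 * indicator {-R..R} t :: real)"
      by simp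
  qed measurable
qed

lemma L2_tendsto_truncation:
  assumes "f \<in> L2"
  shows "L2_tendsto (\<lambda>n t. if \<bar>t\<bar> \<le> real n \<and> norm (f t) \<le> real n then f t else 0) f"
proof (rule L2_tendsto_dominated[OF assms])
  note [measurable] = L2_measurable[OF assms]
  show "(\<lambda>t. if \<bar>t\<bar> \<le> real n \<and> norm (f t) \<le> real n then f t else 0) \<in> borel_measurable borel" for n
    by measurable
  show "AE t in lborel. (\<lambda>n. if \<bar>t\<bar> \<le> real n \<and> norm (f t) \<le> real n then f t else 0) \<longlonglongrightarrow> f t"
  proof (rule AE_I2, rule tendsto_eventually)
    fix t
    have "\<forall>\<^sub>F n in sequentially. max \<bar>t\<bar> (norm (f t)) \<le> real n"
      using filterlim_real_sequentially unfolding filterlim_at_top by blast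
    then show "\<forall>\<^sub>F n in sequentially. (if \<bar>t\<bar> \<le> real n \<and> norm (f t) \<le> real n then f t else 0) = f t"
      by eventually_elim auto
  qed
qed (use L2_measurable[OF assms] in auto)

text \<open>Measurability supplies continuous functions converging to \<open>f\<close> off a
  negligible set, with no control of size or support. Radial truncation and a plateau function add
  both without disturbing the limit, and convergence in norm follows by domination.\<close>

lemma L2_approx_Cc_bounded:
  assumes f: "f \<in> borel_measurable borel" "\<And>t. norm (f t) \<le> M" "\<And>t. \<bar>t\<bar> > R \<Longrightarrow> f t = 0"
  shows "\<exists>g. (\<forall>n. continuous_on UNIV (g n) \<and> (\<forall>t. norm (g n t) \<le> max 1 M) \<and> (\<forall>t. \<bar>t\<bar> > R + 1 \<longrightarrow> g n t = 0)) \<and>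
             L2_tendsto g f"
proof -
  have "f measurable_on UNIV"
    by (rule lebesgue_measurable_imp_measurable_on) (use f(1) in \<open>auto intro: measurable_completion\<close>)
  then obtain N h where N: "negligible N" and h: "\<And>n. continuous_on UNIV (h n)"
    and lim: "\<And>t. t \<notin> N \<Longrightarrow> (\<lambda>n. h n t) \<longlonglongrightarrow> f t"
    unfolding measurable_on_def by auto
  define L where "L = max 1 M"
  have L: "L \<ge> 1" "M \<le> L" by (auto simp: L_def)
  \<comment> \<open>The plateau function: 1 for \<open>\<bar>t\<bar> \<le> R\<close>, 0 beyond
    \<open>R + 1\<close>, continuous in between.\<close>
  define u where "u t = max 0 (min 1 (R + 1 - \<bar>t\<bar>))" for t :: real
  \<comment> \<open>The denominator retracts values onto the ball of radius \<open>L\<close>. It is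
    trivial on the values of \<open>f\<close>, whose norm is at most \<open>M \<le> L\<close>;
    taking \<open>L \<ge> 1\<close> keeps the division meaningful when \<open>M\<close> is
    0.\<close>
  define g where "g n t = (u t / max 1 (norm (h n t) / L)) *\<^sub>R h n t" for n t
  have gc: "continuous_on UNIV (g n)" for n
    unfolding g_def u_def using L by (intro continuous_intros h) (auto simp: max_def)
  have gb: "norm (g n t) \<le> L" for n t
  proof -
    have "norm (g n t) = u t * (norm (h n t) / max 1 (norm (h n t) / L))"
      by (simp add: g_def u_def)
    also have "\<dots> \<le> 1 * L"
    proof (rule mult_mono)
      show "norm (h n t) / max 1 (norm (h n t) / L) \<le> L"
        using L by (auto simp: max_def field_simps)
    qed (use L in \<open>auto simp: u_def\<close>)
    finally show ?thesis by simp
  qed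
  have gs: "g n t = 0" if "\<bar>t\<bar> > R + 1" for n t using that by (simp add: g_def u_def)
  have [measurable]: "g n \<in> borel_measurable borel" for n
    using gc by (rule borel_measurable_continuous_onI)
  have "L2_tendsto g f"
  proof (rule L2_tendsto_dominated)
    show "(\<lambda>t. complex_of_real (L * indicator {-(R+1)..R+1} t)) \<in> L2"
      by (rule bounded_support_L2_integrable[of _ L "R+1"]) (use L in \<open>auto simp: indicator_def\<close>)
    show "AE t in lborel. norm (g n t) \<le> norm (complex_of_real (L * indicator {-(R+1)..R+1} t))" for n
      using gb[of n] gs[of _ n] L by (auto simp: indicator_def abs_le_iff not_le norm_mult intro!: AE_I2)
    \<comment> \<open>The exceptional set is only Lebesgue negligible, so the argument runs in the
      completion and is transferred to \<open>lborel\<close> at the end.\<close>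
    have "AE t in lebesgue. t \<notin> N"
      using N by (simp add: negligible_iff_null_sets AE_not_in)
    then have "AE t in lebesgue. (\<lambda>n. g n t) \<longlonglongrightarrow> f t"
    proof eventually_elim
      case (elim t)
      have "(\<lambda>n. g n t) \<longlonglongrightarrow> (u t / max 1 (norm (f t) / L)) *\<^sub>R f t"
        unfolding g_def by (intro tendsto_intros lim elim) (use L in \<open>auto simp: max_def\<close>)
      also have "max 1 (norm (f t) / L) = 1"
        using f(2)[of t] L by (auto simp: max_def field_simps)
      also have "(u t / 1) *\<^sub>R f t = f t"
        using f(3)[of t] by (cases "\<bar>t\<bar> > R") (auto simp: u_def)
      finally show ?case .
    qed
    then show "AE t in lborel. (\<lambda>n. g n t) \<longlonglongrightarrow> f t"
      by (simp add: AE_completion_iff)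
  qed (use f in auto)
  with gc gb gs show ?thesis unfolding L_def by blast
qed

lemma L2_dense_Cc:
  assumes "f \<in> L2" "e > 0"
  obtains g M R where "continuous_on UNIV g" "\<And>t. norm (g t) \<le> M" "\<And>t. \<bar>t\<bar> > R \<Longrightarrow> g t = 0"
    "L2_norm (\<lambda>t. f t - g t) < e"
proof -
  note [measurable] = L2_measurable[OF assms(1)]
  let ?F = "\<lambda>n t. if \<bar>t\<bar> \<le> real n \<and> norm (f t) \<le> real n then f t else 0"
  have "\<forall>\<^sub>F n in sequentially. L2_norm (\<lambda>t. ?F n t - f t) < e / 2"
    using order_tendstoD(2)[OF L2_tendstoD(3)[OF L2_tendsto_truncation[OF assms(1)]], of "e/2"] assms(2)
    by simp
  then obtain n where n: "L2_norm (\<lambda>t. ?F n t - f t) < e / 2"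
    by (auto simp: eventually_sequentially)
  have "\<exists>g. (\<forall>k. continuous_on UNIV (g k) \<and> (\<forall>t. norm (g k t) \<le> max 1 (real n)) \<and>
      (\<forall>t. \<bar>t\<bar> > real n + 1 \<longrightarrow> g k t = 0)) \<and> L2_tendsto g (?F n)"
    by (rule L2_approx_Cc_bounded) auto
  then obtain g where g: "\<And>k. continuous_on UNIV (g k)" "\<And>k t. norm (g k t) \<le> max 1 (real n)"
    "\<And>k t. \<bar>t\<bar> > real n + 1 \<Longrightarrow> g k t = 0" and lim: "L2_tendsto g (?F n)" by blast
  have "\<forall>\<^sub>F k in sequentially. L2_norm (\<lambda>t. g k t - ?F n t) < e / 2"
    using order_tendstoD(2)[OF L2_tendstoD(3)[OF lim], of "e/2"] assms(2) by simp
  then obtain k where k: "L2_norm (\<lambda>t. g k t - ?F n t) < e / 2"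
    by (auto simp: eventually_sequentially)
  show ?thesis
  proof (rule that[OF g(1) g(2) g(3)])
    show "L2_norm (\<lambda>t. f t - g k t) < e"
      using L2_norm_triangle_diff[OF L2_tendstoD(1,2)[OF lim] assms(1), of k] n k
      by (simp add: L2_norm_minus_commute[of f])
  qed
qed

section \<open>The Fourier transform on integrable functions\<close>

lemma borel_measurable_cis [measurable]: "cis \<in> borel_measurable borel"
  by (intro borel_measurable_continuous_onI continuous_intros)

lemma fourier_cis: "fourier f \<xi> = (LINT x|lborel. f x * cis (- (2 * pi * \<xi> * x)))"
proof -
  have "exp (- 2 * complex_of_real pi * \<i> * complex_of_real \<xi> * complex_of_real x) = cis (- (2 * pi * \<xi> * x))" for x
    by (simp add: cis_conv_exp algebra_simps)
  then show ?thesis unfolding fourier_def by simp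
qed

lemma integrable_mult_unimodular:
  fixes f :: "real \<Rightarrow> complex"
  assumes "integrable lborel f" "c \<in> borel_measurable borel" "\<And>x. norm (c x) = 1"
  shows "integrable lborel (\<lambda>x. f x * c x)"
  by (rule Bochner_Integration.integrable_bound[OF assms(1)])
     (use assms borel_measurable_integrable[OF assms(1)] in \<open>auto simp: norm_mult\<close>)

lemma integrable_fourier_kernel:
  "integrable lborel f \<Longrightarrow> integrable lborel (\<lambda>x. f x * cis (- (2 * pi * \<xi> * x)))"
  by (rule integrable_mult_unimodular) auto

lemma fourier_measurable:
  assumes "integrable lborel f" shows "fourier f \<in> borel_measurable borel"
proof -
  note [measurable] = borel_measurable_integrable[OF assms]
  have "(\<lambda>\<xi>. LINT x|lborel. f x * cis (- (2 * pi * \<xi> * x))) \<in> borel_measurable borel"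
    by measurable
  then show ?thesis by (simp add: fourier_cis[abs_def])
qed

lemma fourier_bound: "norm (fourier f \<xi>) \<le> (LINT x|lborel. norm (f x))"
  unfolding fourier_cis by (rule order_trans[OF integral_norm_bound]) (simp add: norm_mult)

lemma fourier_add:
  assumes "integrable lborel f" "integrable lborel g"
  shows "fourier (\<lambda>x. f x + g x) \<xi> = fourier f \<xi> + fourier g \<xi>"
  unfolding fourier_cis using assms[THEN integrable_fourier_kernel] by (simp add: distrib_right)

lemma fourier_cmult: "fourier (\<lambda>x. c * f x) \<xi> = c * fourier f \<xi>"
  unfolding fourier_cis by (simp add: mult.assoc)

lemma fourier_diff:
  assumes "integrable lborel f" "integrable lborel g"
  shows "fourier (\<lambda>x. f x - g x) \<xi> = fourier f \<xi> - fourier g \<xi>"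
  unfolding fourier_cis using assms[THEN integrable_fourier_kernel] by (simp add: left_diff_distrib)

text \<open>Makes a conjugated transform a transform of an integrable function again, so that the
  multiplication formula also applies to it.\<close>

lemma cnj_fourier:
  "cnj (fourier f \<xi>) = fourier (\<lambda>x. cnj (f (- x))) \<xi>"
proof -
  have "cnj (fourier f \<xi>) = (LINT x|lborel. cnj (f x) * cis (2 * pi * \<xi> * x))"
    unfolding fourier_cis by (simp flip: Bochner_Integration.integral_cnj add: cis_cnj)
  also have "\<dots> = fourier (\<lambda>x. cnj (f (- x))) \<xi>"
    unfolding fourier_cis by (subst lborel_integral_real_affine[where c = "-1" and t = 0]) simp_all
  finally show ?thesis .
qed

text \<open>Fubini: the kernel is symmetric in \<open>x\<close> and \<xi> and has modulus 1, so
  \<open>norm (f x) * norm (v \<xi>)\<close> is a majorant. This formula does the work that Fourier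
  inversion would otherwise do.\<close>

lemma fourier_multiplication:
  assumes f: "integrable lborel f" and v: "integrable lborel v"
  shows "(LINT \<xi>|lborel. fourier f \<xi> * v \<xi>) = (LINT x|lborel. f x * fourier v x)"
proof -
  note [measurable] = borel_measurable_integrable[OF f] borel_measurable_integrable[OF v]
  have int: "integrable (lborel \<Otimes>\<^sub>M lborel) (\<lambda>(x, \<xi>). f x * v \<xi> * cis (- (2 * pi * \<xi> * x)))"
  proof (rule lborel_pair.Fubini_integrable)
    show "integrable lborel (\<lambda>x. LINT \<xi>|lborel. norm (case (x, \<xi>) of (x, \<xi>) \<Rightarrow> f x * v \<xi> * cis (- (2 * pi * \<xi> * x))))"
      using f by (simp add: norm_mult)
    have "integrable lborel (\<lambda>\<xi>. f x * v \<xi> * cis (- (2 * pi * \<xi> * x)))" for x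
      by (rule integrable_mult_unimodular) (use v in auto)
    then show "AE x in lborel. integrable lborel (\<lambda>\<xi>. case (x, \<xi>) of (x, \<xi>) \<Rightarrow> f x * v \<xi> * cis (- (2 * pi * \<xi> * x)))"
      by simp
  qed measurable
  have "(LINT \<xi>|lborel. fourier f \<xi> * v \<xi>) = (LINT \<xi>|lborel. LINT x|lborel. f x * v \<xi> * cis (- (2 * pi * \<xi> * x)))"
  proof (rule Bochner_Integration.integral_cong[OF refl])
    fix \<xi>
    show "fourier f \<xi> * v \<xi> = (LINT x|lborel. f x * v \<xi> * cis (- (2 * pi * \<xi> * x)))"
      unfolding fourier_cis by (subst integral_mult_left_zero[symmetric]) (simp add: mult_ac)
  qed
  also have "\<dots> = (LINT x|lborel. LINT \<xi>|lborel. f x * v \<xi> * cis (- (2 * pi * \<xi> * x)))"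
    by (rule lborel_pair.Fubini_integral[OF int])
  also have "\<dots> = (LINT x|lborel. f x * fourier v x)"
    unfolding fourier_cis by (simp add: mult_ac)
  finally show ?thesis .
qed

section \<open>Gaussian regularisation and Plancherel for integrable functions\<close>

text \<open>After rescaling by \<open>2 * pi * \<eta>\<close> this is the characteristic function of
  the standard normal distribution, known in closed form.\<close>

lemma fourier_gaussian:
  assumes "\<eta> > 0"
  shows "fourier (\<lambda>\<xi>. complex_of_real (exp (- (2 * pi * \<eta> * \<xi>)\<^sup>2 / 2))) u = complex_of_real (normal_density 0 \<eta> u)"
proof -
  have "(LINT \<xi>|lborel. complex_of_real (exp (- (2 * pi * \<eta> * \<xi>)\<^sup>2 / 2)) * cis (- (2 * pi * u * \<xi>)))
     = (1 / (2 * pi * \<eta>)) *\<^sub>R (LINT s|lborel. complex_of_real (exp (- s\<^sup>2 / 2)) * cis (- (u / \<eta>) * s))"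
    by (subst lborel_integral_real_affine[where c = "1 / (2 * pi * \<eta>)" and t = 0])
       (use assms in \<open>simp_all add: field_simps\<close>)
  also have "(LINT s|lborel. complex_of_real (exp (- s\<^sup>2 / 2)) * cis (- (u / \<eta>) * s))
     = complex_of_real (sqrt (2 * pi)) * (LINT s|lborel. std_normal_density s *\<^sub>R iexp (- (u / \<eta>) * s))"
    by (subst integral_mult_right_zero[symmetric])
       (simp add: std_normal_density_def cis_conv_exp scaleR_conv_of_real)
  also have "(LINT s|lborel. std_normal_density s *\<^sub>R iexp (- (u / \<eta>) * s)) = char std_normal_distribution (- (u / \<eta>))"
    unfolding char_def by (subst integral_density) auto
  also have "\<dots> = complex_of_real (exp (- (u / \<eta>)\<^sup>2 / 2))"
    by (simp add: char_std_normal_distribution)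
  also have "(1 / (2 * pi * \<eta>)) *\<^sub>R (complex_of_real (sqrt (2 * pi)) * complex_of_real (exp (- (u / \<eta>)\<^sup>2 / 2)))
      = complex_of_real ((sqrt (2 * pi) / (2 * pi * \<eta>)) * exp (- (u / \<eta>)\<^sup>2 / 2))"
    by (simp add: scaleR_conv_of_real)
  also have "(sqrt (2 * pi) / (2 * pi * \<eta>)) = 1 / (sqrt (2 * pi) * \<eta>)"
    using assms real_sqrt_mult_self[of "2 * pi"] by (simp add: divide_simps del: real_sqrt_mult_self)
  also have "1 / (sqrt (2 * pi) * \<eta>) * exp (- (u / \<eta>)\<^sup>2 / 2) = normal_density 0 \<eta> u"
    using assms by (simp add: normal_density_def real_sqrt_mult power_divide field_simps)
  finally show ?thesis unfolding fourier_cis .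
qed

lemma integrable_gaussian_weight:
  assumes "\<eta> > 0" shows "integrable lborel (\<lambda>\<xi>::real. exp (- (2 * pi * \<eta> * \<xi>)\<^sup>2 / 2))"
proof -
  have "integrable lborel (\<lambda>x. std_normal_density (0 + (2 * pi * \<eta>) * x))"
    by (rule lborel_integrable_real_affine) (use assms in auto)
  then have "integrable lborel (\<lambda>x. sqrt (2 * pi) * std_normal_density (0 + (2 * pi * \<eta>) * x))"
    by simp
  then show ?thesis by (simp add: std_normal_density_def)
qed

text \<open>Applying the multiplication formula twice trades the Gaussian weight on the frequency side
  for a Gaussian average of translates on the time side.\<close>

lemma gaussian_energy_identity:
  assumes f: "integrable lborel f" and "\<eta> > 0"
  shows "complex_of_real (LINT \<xi>|lborel. (norm (fourier f \<xi>))\<^sup>2 * exp (- (2 * pi * \<eta> * \<xi>)\<^sup>2 / 2))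
    = (LINT x|lborel. f x * (LINT u|lborel. cnj (f (x + \<eta> * u)) * std_normal_density u))"
proof -
  note [measurable] = borel_measurable_integrable[OF f] fourier_measurable[OF f]
  let ?w = "\<lambda>\<xi>. complex_of_real (exp (- (2 * pi * \<eta> * \<xi>)\<^sup>2 / 2))"
  let ?f' = "\<lambda>y. cnj (f (- y))"
  have f': "integrable lborel ?f'"
    using lborel_integrable_real_affine[OF f, of "-1" 0] by (simp add: Bochner_Integration.integrable_cnj)
  have w: "integrable lborel ?w" using integrable_gaussian_weight[OF assms(2)] by (rule integrable_of_real)
  \<comment> \<open>A bounded function times a Gaussian, hence integrable: the weight is what makes
    the multiplication formula applicable on the frequency side.\<close>
  define v where "v \<xi> = cnj (fourier f \<xi>) * ?w \<xi>" for \<xi>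
  have v: "integrable lborel v"
  proof (rule Bochner_Integration.integrable_bound)
    show "integrable lborel (\<lambda>\<xi>. (LINT x|lborel. norm (f x)) * exp (- (2 * pi * \<eta> * \<xi>)\<^sup>2 / 2))"
      using integrable_gaussian_weight[OF assms(2)] by simp
    show "v \<in> borel_measurable lborel" unfolding v_def by measurable
    show "AE \<xi> in lborel. norm (v \<xi>) \<le> norm ((LINT x|lborel. norm (f x)) * exp (- (2 * pi * \<eta> * \<xi>)\<^sup>2 / 2))"
      unfolding v_def norm_mult using fourier_bound[of f]
      by (intro AE_I2 mult_mono) (auto intro: order_trans[OF _ abs_ge_self])
  qed
  have fv: "fourier v x = (LINT u|lborel. cnj (f (x + \<eta> * u)) * std_normal_density u)" for x
  proof -
    let ?wx = "\<lambda>\<xi>. ?w \<xi> * cis (- (2 * pi * x * \<xi>))"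
    have "fourier v x = (LINT \<xi>|lborel. fourier ?f' \<xi> * ?wx \<xi>)"
      unfolding fourier_cis[of v] v_def cnj_fourier by (simp add: mult.assoc)
    also have "\<dots> = (LINT y|lborel. ?f' y * fourier ?wx y)"
      by (rule fourier_multiplication[OF f' integrable_fourier_kernel[OF w]])
    also have "\<dots> = (LINT y|lborel. ?f' y * normal_density 0 \<eta> (x + y))"
    proof -
      have "?wx \<xi> * cis (- (2 * pi * y * \<xi>)) = ?w \<xi> * cis (- (2 * pi * (x + y) * \<xi>))" for y \<xi>
        by (simp only: mult.assoc cis_mult) (simp add: algebra_simps)
      then have "fourier ?wx y = fourier ?w (x + y)" for y unfolding fourier_cis by (simp only:)
      then show ?thesis by (simp only: fourier_gaussian[OF assms(2)])
    qed
    \<comment> \<open>The substitution \<open>y = - x - \<eta> * u\<close> centres the Gaussian and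
      normalises its variance, so that \<eta> enters only through the translate of
      \<open>f\<close>.\<close>
    also have "\<dots> = \<bar>-\<eta>\<bar> *\<^sub>R (LINT u|lborel. ?f' (- x + - \<eta> * u) * normal_density 0 \<eta> (x + (- x + - \<eta> * u)))"
      by (rule lborel_integral_real_affine) (use assms in simp)
    also have "\<dots> = (LINT u|lborel. \<bar>-\<eta>\<bar> *\<^sub>R (?f' (- x + - \<eta> * u) * normal_density 0 \<eta> (x + (- x + - \<eta> * u))))"
      by simp
    also have "\<dots> = (LINT u|lborel. cnj (f (x + \<eta> * u)) * std_normal_density u)"
    proof (rule Bochner_Integration.integral_cong[OF refl])
      fix u
      have "\<eta> * normal_density 0 \<eta> (- (\<eta> * u)) = std_normal_density u"
        using assms(2) by (simp add: normal_density_def real_sqrt_mult field_simps power2_eq_square)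
      then have e: "complex_of_real (std_normal_density u) = complex_of_real \<eta> * complex_of_real (normal_density 0 \<eta> (- (\<eta> * u)))"
        by (simp flip: of_real_mult)
      show "\<bar>-\<eta>\<bar> *\<^sub>R (?f' (- x + - \<eta> * u) * normal_density 0 \<eta> (x + (- x + - \<eta> * u)))
          = cnj (f (x + \<eta> * u)) * std_normal_density u"
        unfolding e using assms(2) by (simp add: scaleR_conv_of_real mult_ac add.commute)
    qed
    finally show ?thesis .
  qed
  have "complex_of_real (LINT \<xi>|lborel. (norm (fourier f \<xi>))\<^sup>2 * exp (- (2 * pi * \<eta> * \<xi>)\<^sup>2 / 2))
      = (LINT \<xi>|lborel. complex_of_real ((norm (fourier f \<xi>))\<^sup>2 * exp (- (2 * pi * \<eta> * \<xi>)\<^sup>2 / 2)))"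
    by (rule integral_complex_of_real[symmetric])
  also have "\<dots> = (LINT \<xi>|lborel. fourier f \<xi> * v \<xi>)"
    unfolding v_def by (simp only: of_real_mult complex_norm_square mult.assoc)
  also have "\<dots> = (LINT x|lborel. f x * fourier v x)" by (rule fourier_multiplication[OF f v])
  finally show ?thesis unfolding fv .
qed

lemma norm_integral_le_nn_integral:
  fixes f :: "'a \<Rightarrow> complex"
  shows "ennreal (norm (LINT x|M. f x)) \<le> (\<integral>\<^sup>+x. ennreal (norm (f x)) \<partial>M)"
  by (cases "integrable M f") (auto simp: integral_norm_bound_ennreal not_integrable_integral_eq)

lemma nn_integral_L2_norm:
  assumes "f \<in> L2" shows "(\<integral>\<^sup>+x. ennreal ((norm (f x))\<^sup>2) \<partial>lborel) = ennreal ((L2_norm f)\<^sup>2)"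
  unfolding L2_norm_sq by (rule nn_integral_eq_integral[OF L2_integrable_sq[OF assms]]) auto

text \<open>The energy is an average of products of \<open>f\<close> with its translates, and
  \<open>2 * a * b \<le> a\<^sup>2 + b\<^sup>2\<close> splits its bound into two parts. Each is half
  of the squared norm, since the Gaussian has mass 1 and Lebesgue measure is translation invariant.
  Nonnegative integrals avoid all questions of integrability.\<close>

lemma gaussian_energy_le:
  assumes f: "integrable lborel f" "f \<in> L2" and "\<eta> > 0"
  shows "(LINT \<xi>|lborel. (norm (fourier f \<xi>))\<^sup>2 * exp (- (2 * pi * \<eta> * \<xi>)\<^sup>2 / 2)) \<le> (L2_norm f)\<^sup>2"
    (is "?E \<le> _")
proof -
  note [measurable] = L2_measurable[OF f(2)]
  let ?n = "std_normal_density"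
  let ?P = "ennreal ((L2_norm f)\<^sup>2)"
  have n1: "(\<integral>\<^sup>+u. ennreal (?n u) \<partial>lborel) = 1"
    by (subst nn_integral_eq_integral) auto
  have E0: "0 \<le> ?E" by (intro Bochner_Integration.integral_nonneg) auto
  have "ennreal ?E = ennreal (norm (complex_of_real ?E))" using E0 by simp
  also have "\<dots> \<le> (\<integral>\<^sup>+x. ennreal (norm (f x * (LINT u|lborel. cnj (f (x + \<eta> * u)) * ?n u))) \<partial>lborel)"
    unfolding gaussian_energy_identity[OF f(1) assms(3)] by (rule norm_integral_le_nn_integral)
  also have "\<dots> \<le> (\<integral>\<^sup>+x. (\<integral>\<^sup>+u. ennreal (1/2 * (norm (f x))\<^sup>2 * ?n u) + ennreal (1/2 * (norm (f (x + \<eta> * u)))\<^sup>2 * ?n u) \<partial>lborel) \<partial>lborel)"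
  proof (rule nn_integral_mono)
    fix x
    have "ennreal (norm (f x * (LINT u|lborel. cnj (f (x + \<eta> * u)) * ?n u)))
        = ennreal (norm (LINT u|lborel. f x * (cnj (f (x + \<eta> * u)) * ?n u)))" by simp
    also have "\<dots> \<le> (\<integral>\<^sup>+u. ennreal (norm (f x * (cnj (f (x + \<eta> * u)) * ?n u))) \<partial>lborel)"
      by (rule norm_integral_le_nn_integral)
    also have "\<dots> \<le> (\<integral>\<^sup>+u. ennreal (1/2 * (norm (f x))\<^sup>2 * ?n u) + ennreal (1/2 * (norm (f (x + \<eta> * u)))\<^sup>2 * ?n u) \<partial>lborel)"
    proof (rule nn_integral_mono)
      fix u
      have "norm (f x) * norm (f (x + \<eta> * u)) \<le> 1/2 * (norm (f x))\<^sup>2 + 1/2 * (norm (f (x + \<eta> * u)))\<^sup>2"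
        using sum_squares_bound[of "norm (f x)" "norm (f (x + \<eta> * u))"] by (simp add: field_simps)
      from mult_right_mono[OF this normal_density_nonneg[of 0 1 u]]
      have "norm (f x * (cnj (f (x + \<eta> * u)) * ?n u)) \<le> 1/2 * (norm (f x))\<^sup>2 * ?n u + 1/2 * (norm (f (x + \<eta> * u)))\<^sup>2 * ?n u"
        by (simp add: norm_mult algebra_simps)
      then show "ennreal (norm (f x * (cnj (f (x + \<eta> * u)) * ?n u)))
          \<le> ennreal (1/2 * (norm (f x))\<^sup>2 * ?n u) + ennreal (1/2 * (norm (f (x + \<eta> * u)))\<^sup>2 * ?n u)"
        by (simp add: ennreal_leI flip: ennreal_plus)
    qed
    finally show "ennreal (norm (f x * (LINT u|lborel. cnj (f (x + \<eta> * u)) * ?n u))) \<le> \<dots>" .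
  qed
  also have "\<dots> = (\<integral>\<^sup>+x. (\<integral>\<^sup>+u. ennreal (1/2 * (norm (f x))\<^sup>2 * ?n u) \<partial>lborel) \<partial>lborel)
      + (\<integral>\<^sup>+x. (\<integral>\<^sup>+u. ennreal (1/2 * (norm (f (x + \<eta> * u)))\<^sup>2 * ?n u) \<partial>lborel) \<partial>lborel)"
    by (subst nn_integral_add[symmetric], measurable)
       (intro nn_integral_cong, subst nn_integral_add[symmetric], auto)
  also have "(\<integral>\<^sup>+x. (\<integral>\<^sup>+u. ennreal (1/2 * (norm (f x))\<^sup>2 * ?n u) \<partial>lborel) \<partial>lborel) = ennreal (1/2) * ?P"
  proof -
    have "ennreal (1/2 * (norm (f x))\<^sup>2 * ?n u) = ennreal (1/2) * ennreal ((norm (f x))\<^sup>2) * ennreal (?n u)" for x u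
      by (subst ennreal_mult, simp, simp, subst ennreal_mult, simp, simp, rule refl)
    then show ?thesis
      by (simp only:) (simp add: nn_integral_cmult n1 nn_integral_L2_norm[OF f(2)])
  qed
  also have "(\<integral>\<^sup>+x. (\<integral>\<^sup>+u. ennreal (1/2 * (norm (f (x + \<eta> * u)))\<^sup>2 * ?n u) \<partial>lborel) \<partial>lborel)
      = (\<integral>\<^sup>+u. (\<integral>\<^sup>+x. ennreal (1/2 * (norm (f (x + \<eta> * u)))\<^sup>2 * ?n u) \<partial>lborel) \<partial>lborel)"
    by (rule lborel_pair.Fubini') measurable
  also have "\<dots> = (\<integral>\<^sup>+u. (ennreal (1/2) * ?P) * ennreal (?n u) \<partial>lborel)"
  proof (rule nn_integral_cong)
    fix u
    have "(\<integral>\<^sup>+x. ennreal ((norm (f (x + \<eta> * u)))\<^sup>2) \<partial>lborel) = ?P"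
      using nn_integral_real_affine[of "\<lambda>x. ennreal ((norm (f x))\<^sup>2)" 1 "\<eta> * u"]
      by (simp add: nn_integral_L2_norm[OF f(2)] add.commute)
    moreover have "ennreal (1/2 * (norm (f (x + \<eta> * u)))\<^sup>2 * ?n u) = ennreal (1/2) * ennreal ((norm (f (x + \<eta> * u)))\<^sup>2) * ennreal (?n u)" for x
      by (subst ennreal_mult, simp, simp, subst ennreal_mult, simp, simp, rule refl)
    ultimately show "(\<integral>\<^sup>+x. ennreal (1/2 * (norm (f (x + \<eta> * u)))\<^sup>2 * ?n u) \<partial>lborel) = (ennreal (1/2) * ?P) * ennreal (?n u)"
      by (simp only:) (simp add: nn_integral_cmult nn_integral_multc)
  qed
  also have "\<dots> = ennreal (1/2) * ?P" by (simp add: nn_integral_cmult n1)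
  also have "ennreal (1/2) * ?P + ennreal (1/2) * ?P = ?P"
  proof -
    have "ennreal (1/2) + ennreal (1/2) = 1" by (subst ennreal_plus[symmetric]) auto
    then show ?thesis by (simp only: distrib_right[symmetric] mult_1)
  qed
  finally show ?thesis by simp
qed

text \<open>Fatou along \<eta> tending to 0 turns the uniform bound on the weighted energies into
  square integrability of the transform. Fatou yields an inequality only; equality also needs the
  limit of the time side.\<close>

lemma fourier_contraction:
  assumes f: "integrable lborel f" "f \<in> L2"
  shows "fourier f \<in> L2" "L2_norm (fourier f) \<le> L2_norm f"
proof -
  note [measurable] = fourier_measurable[OF f(1)]
  let ?\<eta> = "\<lambda>k. inverse (real (Suc k))"
  let ?E = "\<lambda>k \<xi>. (norm (fourier f \<xi>))\<^sup>2 * exp (- (2 * pi * ?\<eta> k * \<xi>)\<^sup>2 / 2)"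
  have lim: "(\<lambda>k. ?E k \<xi>) \<longlonglongrightarrow> (norm (fourier f \<xi>))\<^sup>2" for \<xi>
  proof -
    have "(\<lambda>k. ?E k \<xi>) \<longlonglongrightarrow> (norm (fourier f \<xi>))\<^sup>2 * exp (- (2 * pi * 0 * \<xi>)\<^sup>2 / 2)"
      by (intro tendsto_intros LIMSEQ_inverse_real_of_nat) simp
    then show ?thesis by simp
  qed
  have int: "integrable lborel (?E k)" for k
  proof (rule Bochner_Integration.integrable_bound)
    show "integrable lborel (\<lambda>\<xi>. (LINT x|lborel. norm (f x))\<^sup>2 * exp (- (2 * pi * ?\<eta> k * \<xi>)\<^sup>2 / 2))"
      using integrable_gaussian_weight[of "?\<eta> k"] by simp
    have "(norm (fourier f \<xi>))\<^sup>2 \<le> (LINT x|lborel. norm (f x))\<^sup>2" for \<xi>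
      by (intro power_mono fourier_bound) simp
    then show "AE \<xi> in lborel. norm (?E k \<xi>) \<le> norm ((LINT x|lborel. norm (f x))\<^sup>2 * exp (- (2 * pi * ?\<eta> k * \<xi>)\<^sup>2 / 2))"
      by (intro AE_I2) (simp add: abs_mult)
  qed measurable
  have "(\<integral>\<^sup>+\<xi>. ennreal ((norm (fourier f \<xi>))\<^sup>2) \<partial>lborel) = (\<integral>\<^sup>+\<xi>. liminf (\<lambda>k. ennreal (?E k \<xi>)) \<partial>lborel)"
    by (intro nn_integral_cong lim_imp_Liminf[symmetric] tendsto_ennrealI lim) simp
  also have "\<dots> \<le> liminf (\<lambda>k. \<integral>\<^sup>+\<xi>. ennreal (?E k \<xi>) \<partial>lborel)"
    by (rule nn_integral_liminf) measurable
  also have "\<dots> \<le> liminf (\<lambda>k. ennreal ((L2_norm f)\<^sup>2))"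
  proof (intro Liminf_mono always_eventually allI)
    fix k
    have "(\<integral>\<^sup>+\<xi>. ennreal (?E k \<xi>) \<partial>lborel) = ennreal (LINT \<xi>|lborel. ?E k \<xi>)"
      by (rule nn_integral_eq_integral[OF int]) auto
    then show "(\<integral>\<^sup>+\<xi>. ennreal (?E k \<xi>) \<partial>lborel) \<le> ennreal ((L2_norm f)\<^sup>2)"
      using gaussian_energy_le[OF f, of "?\<eta> k"] by (simp add: ennreal_leI)
  qed
  also have "\<dots> = ennreal ((L2_norm f)\<^sup>2)" by (simp add: Liminf_const)
  finally have le: "(\<integral>\<^sup>+\<xi>. ennreal ((norm (fourier f \<xi>))\<^sup>2) \<partial>lborel) \<le> ennreal ((L2_norm f)\<^sup>2)" .
  show L2: "fourier f \<in> L2"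
    by (rule L2I, measurable, rule integrableI_nonneg)
       (use le in \<open>auto intro: order.strict_trans1[OF le]\<close>)
  have "(L2_norm (fourier f))\<^sup>2 \<le> (L2_norm f)\<^sup>2"
    using le unfolding nn_integral_L2_norm[OF L2] by simp
  then show "L2_norm (fourier f) \<le> L2_norm f" by (rule power2_le_imp_le) simp
qed

text \<open>Square integrability of the transform is now known, so the weighted energies converge by
  domination. On the time side, continuity makes the averaged translates tend to
  \<open>cnj (f x)\<close> at every point.\<close>

lemma fourier_isometry_Cc:
  assumes f: "continuous_on UNIV f" "\<And>t. norm (f t) \<le> M" "\<And>t. \<bar>t\<bar> > R \<Longrightarrow> f t = 0"
  shows "L2_norm (fourier f) = L2_norm f"
proof -
  have fm [measurable]: "f \<in> borel_measurable borel"
    using f(1) by (rule borel_measurable_continuous_onI)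
  note fL2 = bounded_support_L2_integrable(1)[where R = R, OF fm f(2,3)]
  note fint = bounded_support_L2_integrable(2)[where R = R, OF fm f(2,3)]
  note [measurable] = fourier_measurable[OF fint]
  have M: "0 \<le> M" using order_trans[OF norm_ge_zero f(2)] .
  let ?\<eta> = "\<lambda>k. inverse (real (Suc k))"
  let ?n = "std_normal_density"
  let ?E = "\<lambda>k \<xi>. (norm (fourier f \<xi>))\<^sup>2 * exp (- (2 * pi * ?\<eta> k * \<xi>)\<^sup>2 / 2)"
  let ?A = "\<lambda>k x. LINT u|lborel. cnj (f (x + ?\<eta> k * u)) * ?n u"
  have lhs: "(\<lambda>k. LINT \<xi>|lborel. ?E k \<xi>) \<longlonglongrightarrow> (LINT \<xi>|lborel. (norm (fourier f \<xi>))\<^sup>2)"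
  proof (rule integral_dominated_convergence)
    show "integrable lborel (\<lambda>\<xi>. (norm (fourier f \<xi>))\<^sup>2)"
      by (rule L2_integrable_sq[OF fourier_contraction(1)[OF fint fL2]])
    show "AE \<xi> in lborel. (\<lambda>k. ?E k \<xi>) \<longlonglongrightarrow> (norm (fourier f \<xi>))\<^sup>2"
    proof (rule AE_I2)
      fix \<xi>
      have "(\<lambda>k. ?E k \<xi>) \<longlonglongrightarrow> (norm (fourier f \<xi>))\<^sup>2 * exp (- (2 * pi * 0 * \<xi>)\<^sup>2 / 2)"
        by (intro tendsto_intros LIMSEQ_inverse_real_of_nat) simp
      then show "(\<lambda>k. ?E k \<xi>) \<longlonglongrightarrow> (norm (fourier f \<xi>))\<^sup>2" by simp
    qed
    show "AE \<xi> in lborel. norm (?E k \<xi>) \<le> (norm (fourier f \<xi>))\<^sup>2" for k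
      by (intro AE_I2) (simp add: abs_mult mult_left_le)
  qed measurable
  have Alim: "(\<lambda>k. ?A k x) \<longlonglongrightarrow> cnj (f x)" for x
  proof -
    have "(\<lambda>k. ?A k x) \<longlonglongrightarrow> (LINT u|lborel. cnj (f x) * ?n u)"
    proof (rule integral_dominated_convergence)
      show "integrable lborel (\<lambda>u. M * ?n u)" by simp
      show "AE u in lborel. (\<lambda>k. cnj (f (x + ?\<eta> k * u)) * ?n u) \<longlonglongrightarrow> cnj (f x) * ?n u"
      proof (rule AE_I2)
        fix u
        have "(\<lambda>k. x + ?\<eta> k * u) \<longlonglongrightarrow> x + 0 * u"
          by (intro tendsto_intros LIMSEQ_inverse_real_of_nat)
        then have "(\<lambda>k. f (x + ?\<eta> k * u)) \<longlonglongrightarrow> f x"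
          using f(1) by (intro continuous_on_tendsto_compose[OF f(1)]) auto
        then show "(\<lambda>k. cnj (f (x + ?\<eta> k * u)) * ?n u) \<longlonglongrightarrow> cnj (f x) * ?n u"
          by (intro tendsto_intros)
      qed
      show "AE u in lborel. norm (cnj (f (x + ?\<eta> k * u)) * complex_of_real (?n u)) \<le> M * ?n u" for k
        using f(2) by (intro AE_I2) (simp add: norm_mult mult_right_mono)
    qed measurable
    then show ?thesis by simp
  qed
  have Abound: "norm (?A k x) \<le> M" for k x
  proof -
    have "norm (?A k x) \<le> (LINT u|lborel. norm (cnj (f (x + ?\<eta> k * u)) * complex_of_real (?n u)))"
      by (rule integral_norm_bound)
    also have "\<dots> \<le> (LINT u|lborel. M * ?n u)"
      by (rule integral_mono_AE') (use f(2) M in \<open>auto simp: norm_mult mult_right_mono\<close>)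
    finally show ?thesis by simp
  qed
  have rhs: "(\<lambda>k. LINT x|lborel. f x * ?A k x) \<longlonglongrightarrow> (LINT x|lborel. f x * cnj (f x))"
  proof (rule integral_dominated_convergence)
    show "integrable lborel (\<lambda>x. M * norm (f x))" using fint by simp
    show "AE x in lborel. (\<lambda>k. f x * ?A k x) \<longlonglongrightarrow> f x * cnj (f x)"
      by (intro AE_I2 tendsto_intros Alim)
    show "AE x in lborel. norm (f x * ?A k x) \<le> M * norm (f x)" for k
      unfolding norm_mult mult.commute[of M] by (intro AE_I2 mult_left_mono Abound) simp
  qed measurable
  have "(\<lambda>k. complex_of_real (LINT \<xi>|lborel. ?E k \<xi>)) \<longlonglongrightarrow> complex_of_real (LINT \<xi>|lborel. (norm (fourier f \<xi>))\<^sup>2)"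
    by (intro tendsto_of_real lhs)
  also have "(\<lambda>k. complex_of_real (LINT \<xi>|lborel. ?E k \<xi>)) = (\<lambda>k. LINT x|lborel. f x * ?A k x)"
    by (intro ext gaussian_energy_identity[OF fint] positive_imp_inverse_positive) simp_all
  finally have "complex_of_real ((L2_norm (fourier f))\<^sup>2) = L2_inner f f"
    using LIMSEQ_unique[OF _ rhs] unfolding L2_norm_sq L2_inner_def by blast
  then have "(L2_norm (fourier f))\<^sup>2 = (L2_norm f)\<^sup>2"
    unfolding L2_inner_self of_real_eq_iff .
  then show ?thesis by (metis L2_norm_nonneg power2_eq_imp_eq)
qed

text \<open>Density transfers the isometry: by contraction, replacing \<open>f\<close> by a nearby
  \<open>g\<close> changes either norm by less than \<open>e / 2\<close>.\<close>

lemma plancherel_integrable: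
  assumes f: "integrable lborel f" "f \<in> L2"
  shows "L2_norm (fourier f) = L2_norm f"
proof (rule antisym[OF fourier_contraction(2)[OF f]], rule field_le_epsilon)
  fix e :: real assume "e > 0"
  then obtain g M R where g: "continuous_on UNIV g" "\<And>t. norm (g t) \<le> M" "\<And>t. \<bar>t\<bar> > R \<Longrightarrow> g t = 0"
    "L2_norm (\<lambda>t. f t - g t) < e / 2"
    using L2_dense_Cc[OF f(2), of "e/2"] by (metis half_gt_zero)
  have gm: "g \<in> borel_measurable borel" using g(1) by (rule borel_measurable_continuous_onI)
  note gL2 = bounded_support_L2_integrable(1)[where R = R, OF gm g(2,3)]
  note gint = bounded_support_L2_integrable(2)[where R = R, OF gm g(2,3)]
  have "fourier (\<lambda>x. f x - g x) = (\<lambda>\<xi>. fourier f \<xi> - fourier g \<xi>)"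
    by (rule ext, rule fourier_diff[OF f(1) gint])
  then have "L2_norm (\<lambda>\<xi>. fourier f \<xi> - fourier g \<xi>) = L2_norm (fourier (\<lambda>x. f x - g x))"
    by simp
  also have "\<dots> \<le> L2_norm (\<lambda>x. f x - g x)"
    by (rule fourier_contraction(2)) (use f gint gL2 L2_diff in auto)
  finally have "L2_norm (\<lambda>\<xi>. fourier f \<xi> - fourier g \<xi>) < e / 2" using g(4) by simp
  then show "L2_norm f \<le> L2_norm (fourier f) + e"
    using L2_norm_diff_abs_le[OF f(2) gL2] g(4) fourier_isometry_Cc[where R = R, OF g(1-3)]
      L2_norm_diff_abs_le[OF fourier_contraction(1)[OF f] fourier_contraction(1)[OF gint gL2]]
    by linarith
qed

section \<open>The Fourier transform on square integrable functions\<close>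

lemma has_L2_fourierD: assumes "has_L2_fourier f g" shows "f \<in> L2" "g \<in> L2"
  using assms by (auto simp: has_L2_fourier_def L2_tendsto_def)

lemma has_L2_fourier_integrable:
  assumes "integrable lborel f" "f \<in> L2" shows "has_L2_fourier f (fourier f)"
  unfolding has_L2_fourier_def
  by (intro exI[of _ "\<lambda>n. f"] conjI allI L2_tendsto_const fourier_contraction(1) assms)

lemma has_L2_fourier_exists:
  assumes "f \<in> L2" obtains g where "has_L2_fourier f g"
proof -
  \<comment> \<open>Two consecutive errors have to add up to at most \<open>sqrt ((1/8)^n)\<close>,
    so that the squared increments of the transforms decay at the rate that
    \<open>L2_complete_fast\<close> asks for.\<close>
  define e where "e n = sqrt ((1/8)^n) / 4" for n :: nat
  have e_pos: "e n > 0" for n by (simp add: e_def)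
  have "\<exists>g. integrable lborel g \<and> g \<in> L2 \<and> L2_norm (\<lambda>t. f t - g t) < e n" for n
  proof -
    obtain g M R where g: "continuous_on UNIV g" "\<And>t. norm (g t) \<le> M" "\<And>t. \<bar>t\<bar> > R \<Longrightarrow> g t = 0"
      "L2_norm (\<lambda>t. f t - g t) < e n"
      using L2_dense_Cc[OF assms e_pos] by metis
    have "g \<in> borel_measurable borel" using g(1) by (rule borel_measurable_continuous_onI)
    from bounded_support_L2_integrable[where R = R, OF this g(2,3)] g(4) show ?thesis by blast
  qed
  then obtain F where F: "\<And>n. integrable lborel (F n)" "\<And>n. F n \<in> L2" "\<And>n. L2_norm (\<lambda>t. f t - F n t) < e n"
    by metis
  have e0: "e \<longlonglongrightarrow> 0"
  proof -
    have "(\<lambda>n. sqrt ((1/8)^n) / 4) \<longlonglongrightarrow> sqrt 0 / 4" by (intro tendsto_intros LIMSEQ_power_zero) simp_all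
    then show ?thesis by (simp add: e_def[abs_def])
  qed
  have lim: "L2_tendsto F f"
  proof -
    have "(\<lambda>n. L2_norm (\<lambda>t. F n t - f t)) \<longlonglongrightarrow> 0"
    proof (rule Lim_null_comparison[OF _ e0], intro always_eventually allI)
      show "norm (L2_norm (\<lambda>t. F n t - f t)) \<le> e n" for n
        using F(3)[of n] by (simp add: L2_norm_minus_commute[of f])
    qed
    then show ?thesis using F assms by (simp add: L2_tendsto_def)
  qed
  have "\<exists>g. L2_tendsto (\<lambda>n. fourier (F n)) g"
  proof (rule L2_complete_fast)
    show "fourier (F n) \<in> L2" for n by (rule fourier_contraction(1)[OF F(1,2)])
    fix n
    have "fourier (\<lambda>x. F (Suc n) x - F n x) = (\<lambda>\<xi>. fourier (F (Suc n)) \<xi> - fourier (F n) \<xi>)"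
      by (rule ext, rule fourier_diff[OF F(1) F(1)])
    then have "L2_norm (\<lambda>\<xi>. fourier (F (Suc n)) \<xi> - fourier (F n) \<xi>) = L2_norm (fourier (\<lambda>x. F (Suc n) x - F n x))"
      by simp
    also have "\<dots> \<le> L2_norm (\<lambda>x. F (Suc n) x - F n x)"
      by (rule fourier_contraction(2)[OF Bochner_Integration.integrable_diff[OF F(1) F(1)] L2_diff[OF F(2) F(2)]])
    also have "\<dots> \<le> e (Suc n) + e n"
      using L2_norm_triangle_diff[OF F(2) assms F(2), of "Suc n" n] F(3)[of "Suc n"] F(3)[of n]
      by (simp add: L2_norm_minus_commute[of f])
    also have "\<dots> \<le> sqrt ((1/8)^n)"
    proof -
      have "sqrt ((1/8)^Suc n) \<le> sqrt ((1/8)^n)" by (intro real_sqrt_le_mono power_decreasing) auto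
      moreover have "0 \<le> sqrt ((1/8)^n)" by simp
      ultimately show ?thesis unfolding e_def by linarith
    qed
    finally have "(L2_norm (\<lambda>\<xi>. fourier (F (Suc n)) \<xi> - fourier (F n) \<xi>))\<^sup>2 \<le> (sqrt ((1/8)^n))\<^sup>2"
      by (intro power_mono) auto
    then show "(L2_norm (\<lambda>\<xi>. fourier (F (Suc n)) \<xi> - fourier (F n) \<xi>))\<^sup>2 \<le> 1 * (1/8)^n" by simp
  qed
  then obtain g where "L2_tendsto (\<lambda>n. fourier (F n)) g" ..
  with F(1) lim have "has_L2_fourier f g" unfolding has_L2_fourier_def by blast
  then show ?thesis by (rule that)
qed

lemma has_L2_fourier_add:
  assumes "has_L2_fourier f f'" "has_L2_fourier g g'"
  shows "has_L2_fourier (\<lambda>t. f t + g t) (\<lambda>\<xi>. f' \<xi> + g' \<xi>)"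
proof -
  obtain F G where F: "\<And>n. integrable lborel (F n)" "L2_tendsto F f" "L2_tendsto (\<lambda>n. fourier (F n)) f'"
    and G: "\<And>n. integrable lborel (G n)" "L2_tendsto G g" "L2_tendsto (\<lambda>n. fourier (G n)) g'"
    using assms unfolding has_L2_fourier_def by blast
  show ?thesis unfolding has_L2_fourier_def
  proof (rule exI[of _ "\<lambda>n t. F n t + G n t"], intro conjI allI)
    show "L2_tendsto (\<lambda>n t. F n t + G n t) (\<lambda>t. f t + g t)" by (rule L2_tendsto_add[OF F(2) G(2)])
    have "fourier (\<lambda>t. F n t + G n t) = (\<lambda>\<xi>. fourier (F n) \<xi> + fourier (G n) \<xi>)" for n
      by (rule ext, rule fourier_add[OF F(1) G(1)])
    then show "L2_tendsto (\<lambda>n. fourier (\<lambda>t. F n t + G n t)) (\<lambda>\<xi>. f' \<xi> + g' \<xi>)"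
      using L2_tendsto_add[OF F(3) G(3)] by (simp only:)
    show "integrable lborel (\<lambda>t. F n t + G n t)" for n
      by (rule Bochner_Integration.integrable_add[OF F(1) G(1)])
  qed
qed

lemma has_L2_fourier_cmult:
  assumes "has_L2_fourier f f'" shows "has_L2_fourier (\<lambda>t. c * f t) (\<lambda>\<xi>. c * f' \<xi>)"
proof -
  obtain F where F: "\<And>n. integrable lborel (F n)" "L2_tendsto F f" "L2_tendsto (\<lambda>n. fourier (F n)) f'"
    using assms unfolding has_L2_fourier_def by blast
  show ?thesis unfolding has_L2_fourier_def
  proof (rule exI[of _ "\<lambda>n t. c * F n t"], intro conjI allI)
    have "fourier (\<lambda>t. c * F n t) = (\<lambda>\<xi>. c * fourier (F n) \<xi>)" for n
      by (rule ext, rule fourier_cmult)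
    then show "L2_tendsto (\<lambda>n. fourier (\<lambda>t. c * F n t)) (\<lambda>\<xi>. c * f' \<xi>)"
      using L2_tendsto_cmult[OF F(3)] by (simp only:)
    show "integrable lborel (\<lambda>t. c * F n t)" for n
      by (rule integrable_mult_right[OF F(1)])
    show "L2_tendsto (\<lambda>n t. c * F n t) (\<lambda>t. c * f t)" by (rule L2_tendsto_cmult[OF F(2)])
  qed
qed

lemma has_L2_fourier_diff:
  assumes "has_L2_fourier f f'" "has_L2_fourier g g'"
  shows "has_L2_fourier (\<lambda>t. f t - g t) (\<lambda>\<xi>. f' \<xi> - g' \<xi>)"
  using has_L2_fourier_add[OF assms(1) has_L2_fourier_cmult[OF assms(2), of "-1"]]
  by (simp only: mult_minus1 add_uminus_conv_diff)

lemma plancherel: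
  assumes "has_L2_fourier f f'" shows "L2_norm f' = L2_norm f"
proof -
  obtain F where F: "\<And>n. integrable lborel (F n)" "L2_tendsto F f" "L2_tendsto (\<lambda>n. fourier (F n)) f'"
    using assms unfolding has_L2_fourier_def by blast
  have "L2_norm (fourier (F n)) = L2_norm (F n)" for n
    by (rule plancherel_integrable[OF F(1) L2_tendstoD(1)[OF F(2)]])
  then show ?thesis
    using LIMSEQ_unique[OF L2_tendsto_norm[OF F(2)]] L2_tendsto_norm[OF F(3)] by simp
qed

text \<open>Polarisation: the norm of a difference fixes the real part, and multiplying one argument
  by \<open>- \<i>\<close> turns the imaginary part into a real part.\<close>

lemma parseval:
  assumes "has_L2_fourier f f'" "has_L2_fourier g g'"
  shows "L2_inner f' g' = L2_inner f g"
proof -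
  have re: "Re (L2_inner f' g') = Re (L2_inner f g)"
    if hyp: "has_L2_fourier f f'" "has_L2_fourier g g'" for f f' g g'
  proof -
    note L = has_L2_fourierD[OF hyp(1)] has_L2_fourierD[OF hyp(2)]
    show ?thesis
      using L2_norm_diff_sq[OF L(1,3)] L2_norm_diff_sq[OF L(2,4)]
        plancherel[OF has_L2_fourier_diff[OF hyp]] plancherel[OF hyp(1)] plancherel[OF hyp(2)] by simp
  qed
  have i: "L2_inner (\<lambda>t. - \<i> * f t) g = - \<i> * L2_inner f g" for f g
    unfolding L2_inner_def by (simp add: mult.assoc)
  have "Re (- \<i> * L2_inner f' g') = Re (- \<i> * L2_inner f g)"
    using re[OF has_L2_fourier_cmult[OF assms(1), of "- \<i>"] assms(2)] unfolding i .
  then show ?thesis using re[OF assms] by (simp add: complex_eq_iff)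
qed

text \<open>Plancherel for the difference. One direction is uniqueness of the transform, the other
  its injectivity; together they reduce identities between operators to pointwise identities in
  frequency.\<close>

lemma has_L2_fourier_AE_eq_iff:
  assumes "has_L2_fourier f f'" "has_L2_fourier g g'"
  shows "(AE t in lborel. f t = g t) \<longleftrightarrow> (AE \<xi> in lborel. f' \<xi> = g' \<xi>)"
proof -
  note d = has_L2_fourier_diff[OF assms]
  note D = has_L2_fourierD[OF d]
  have norm0: "L2_norm h = 0 \<longleftrightarrow> (AE t in lborel. h t = 0)" if "h \<in> L2" for h
  proof
    show "AE t in lborel. h t = 0" if "L2_norm h = 0" by (rule L2_norm_eq_0_AE[OF \<open>h \<in> L2\<close> that])
    assume "AE t in lborel. h t = 0"
    then have "L2_norm h = L2_norm (\<lambda>_. 0)"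
      by (intro L2_norm_cong_AE L2_measurable[OF that]) auto
    then show "L2_norm h = 0" by (simp add: L2_norm_def)
  qed
  show ?thesis
    using norm0[OF D(1)] norm0[OF D(2)] plancherel[OF d] by simp
qed

text \<open>A limit of \<open>fourier_multiplication\<close>, taken through inner products;
  conjugating the second factor compensates for their antilinearity.\<close>

lemma has_L2_fourier_multiplication:
  assumes "has_L2_fourier f f'" "has_L2_fourier g g'"
  shows "(LINT \<xi>|lborel. f' \<xi> * g \<xi>) = (LINT x|lborel. f x * g' x)"
proof -
  obtain F G where F: "\<And>n. integrable lborel (F n)" "L2_tendsto F f" "L2_tendsto (\<lambda>n. fourier (F n)) f'"
    and G: "\<And>n. integrable lborel (G n)" "L2_tendsto G g" "L2_tendsto (\<lambda>n. fourier (G n)) g'"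
    using assms unfolding has_L2_fourier_def by blast
  have "(\<lambda>n. LINT \<xi>|lborel. fourier (F n) \<xi> * G n \<xi>) \<longlonglongrightarrow> (LINT \<xi>|lborel. f' \<xi> * g \<xi>)"
    using L2_tendsto_inner[OF F(3) L2_tendsto_cnj[OF G(2)]] by (simp add: L2_inner_def)
  moreover have "(\<lambda>n. LINT x|lborel. F n x * fourier (G n) x) \<longlonglongrightarrow> (LINT x|lborel. f x * g' x)"
    using L2_tendsto_inner[OF F(2) L2_tendsto_cnj[OF G(3)]] by (simp add: L2_inner_def)
  ultimately show ?thesis
    unfolding fourier_multiplication[OF F(1) G(1)] by (rule LIMSEQ_unique)
qed

lemma has_L2_fourier_cong_AE:
  assumes "has_L2_fourier f f'" "g \<in> borel_measurable borel" "AE \<xi> in lborel. f' \<xi> = g \<xi>"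
  shows "has_L2_fourier f g"
proof -
  obtain F where F: "\<And>n. integrable lborel (F n)" "L2_tendsto F f" "L2_tendsto (\<lambda>n. fourier (F n)) f'"
    using assms unfolding has_L2_fourier_def by blast
  have L: "g \<in> L2" by (rule L2_cong_AE[OF has_L2_fourierD(2)[OF assms(1)] assms(2,3)])
  note [measurable] = L2_measurable[OF has_L2_fourierD(2)[OF assms(1)]] L2_measurable[OF L2_tendstoD(1)[OF F(3)]] assms(2)
  have "L2_norm (\<lambda>\<xi>. fourier (F n) \<xi> - f' \<xi>) = L2_norm (\<lambda>\<xi>. fourier (F n) \<xi> - g \<xi>)" for n
  proof (rule L2_norm_cong_AE)
    show "AE \<xi> in lborel. fourier (F n) \<xi> - f' \<xi> = fourier (F n) \<xi> - g \<xi>"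
      using assms(3) by eventually_elim simp
  qed measurable
  then have "L2_tendsto (\<lambda>n. fourier (F n)) g"
    using F(3) L by (simp add: L2_tendsto_def)
  with F show ?thesis unfolding has_L2_fourier_def by blast
qed

text \<open>Surjectivity: by symmetry the candidate preimage of \<open>g\<close> is the conjugate of the
  transform of the conjugate of \<open>g\<close>; the multiplication formula shows that its transform has
  the same norm as \<open>g\<close> and inner product \<open>\<parallel>g\<parallel>\<^sup>2\<close> with \<open>g\<close>, hence equals \<open>g\<close>.\<close>

lemma has_L2_fourier_surj:
  assumes "g \<in> L2" obtains f where "has_L2_fourier f g"
proof -
  obtain k where k: "has_L2_fourier (\<lambda>t. cnj (g t)) k" by (rule has_L2_fourier_exists[OF L2_cnj[OF assms]])
  note kL = has_L2_fourierD[OF k]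
  obtain h where h: "has_L2_fourier (\<lambda>t. cnj (k t)) h" by (rule has_L2_fourier_exists[OF L2_cnj[OF kL(2)]])
  note hL = has_L2_fourierD[OF h]
  have nk: "L2_norm k = L2_norm g" using plancherel[OF k] by simp
  have nh: "L2_norm h = L2_norm g" using plancherel[OF h] nk by simp
  have "L2_inner h g = (LINT x|lborel. cnj (k x) * k x)"
    unfolding L2_inner_def by (rule has_L2_fourier_multiplication[OF h k])
  also have "\<dots> = L2_inner k k" by (simp add: L2_inner_def mult.commute)
  also have "\<dots> = (L2_norm g)\<^sup>2" by (simp add: L2_inner_self nk)
  finally have "(L2_norm (\<lambda>t. h t - g t))\<^sup>2 = 0"
    using L2_norm_diff_sq[OF hL(2) assms] by (simp add: nh)
  then have "AE t in lborel. h t = g t"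
    using L2_norm_eq_0_AE[OF L2_diff[OF hL(2) assms]] by simp
  from has_L2_fourier_cong_AE[OF h L2_measurable[OF assms] this] show ?thesis by (rule that)
qed

section \<open>Atoms and Fourier multipliers\<close>

text \<open>The factor \<open>sqrt a\<close> cancels the Jacobian, and \<open>c\<close> is an
  arbitrary phase. One form covers both the atom in time, where \<open>a\<close> is 1/\<beta>, and
  its transform in frequency, where \<open>a\<close> is \<beta>.\<close>

lemma L2_affine:
  assumes f: "f \<in> L2" and a: "a > 0" and c: "c \<in> borel_measurable borel" "\<And>t. norm (c t) = 1"
  shows "(\<lambda>t. c t * (complex_of_real (sqrt a) * f (b + a * t))) \<in> L2"
    and "L2_norm (\<lambda>t. c t * (complex_of_real (sqrt a) * f (b + a * t))) = L2_norm f"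
proof -
  note [measurable] = L2_measurable[OF f] c(1)
  have n: "(norm (c t * (complex_of_real (sqrt a) * f (b + a * t))))\<^sup>2 = a * (norm (f (b + a * t)))\<^sup>2" for t
    using a by (simp add: norm_mult c(2) power_mult_distrib)
  show "(\<lambda>t. c t * (complex_of_real (sqrt a) * f (b + a * t))) \<in> L2"
  proof (rule L2I)
    show "integrable lborel (\<lambda>t. (norm (c t * (complex_of_real (sqrt a) * f (b + a * t))))\<^sup>2)"
      unfolding n using lborel_integrable_real_affine[OF L2_integrable_sq[OF f], of a b] a by simp
  qed measurable
  have "(LINT t|lborel. a * (norm (f (b + a * t)))\<^sup>2) = (LINT t|lborel. (norm (f t))\<^sup>2)"
    using lborel_integral_real_affine[of a "\<lambda>t. (norm (f t))\<^sup>2" b] a by simp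
  then show "L2_norm (\<lambda>t. c t * (complex_of_real (sqrt a) * f (b + a * t))) = L2_norm f"
    unfolding L2_norm_def n by simp
qed

lemma L2_tendsto_affine:
  assumes F: "L2_tendsto F f" and a: "a > 0" and c: "c \<in> borel_measurable borel" "\<And>t. norm (c t) = 1"
  shows "L2_tendsto (\<lambda>n t. c t * (complex_of_real (sqrt a) * F n (b + a * t)))
    (\<lambda>t. c t * (complex_of_real (sqrt a) * f (b + a * t)))"
proof -
  note L = L2_tendstoD[OF F]
  have "L2_norm (\<lambda>t. c t * (complex_of_real (sqrt a) * F n (b + a * t)) - c t * (complex_of_real (sqrt a) * f (b + a * t)))
      = L2_norm (\<lambda>t. F n t - f t)" for n
    using L2_affine(2)[OF L2_diff[OF L(1,2)] a c, where b = b] by (simp only: right_diff_distrib)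
  then show ?thesis
    unfolding L2_tendsto_def using L(3) by (simp only: L2_affine(1)[OF _ a c] L(1,2) simp_thms)
qed

text \<open>Under \<open>t = x + a * s\<close> the two phases recombine into one that does not
  depend on \<open>s\<close> and the kernel at frequency \<open>a * (\<xi> - \<omega>)\<close>; the
  Jacobian \<open>a\<close> turns \<open>sqrt (1 / a)\<close> into \<open>sqrt a\<close>.\<close>

lemma fourier_affine:
  assumes a: "a > 0"
  shows "fourier (\<lambda>t. cis (2 * pi * \<omega> * (t - x)) * (complex_of_real (sqrt (1 / a)) * f (- x / a + 1 / a * t))) \<xi>
    = cis (- (2 * pi * x * \<xi>)) * (complex_of_real (sqrt a) * fourier f (- (a * \<omega>) + a * \<xi>))"
proof -
  have cis_sum: "cis (2 * pi * \<omega> * (x + a * s - x)) * cis (- (2 * pi * \<xi> * (x + a * s)))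
      = cis (- (2 * pi * x * \<xi>)) * cis (- (2 * pi * (- (a * \<omega>) + a * \<xi>) * s))" for s
    by (simp only: cis_mult) (simp add: algebra_simps)
  have sq: "a * sqrt (1 / a) = sqrt a"
    using a by (simp add: real_sqrt_divide real_div_sqrt)
  have arg: "- x / a + 1 / a * (x + a * s) = s" for s
    using a by (simp add: field_simps)
  have "fourier (\<lambda>t. cis (2 * pi * \<omega> * (t - x)) * (complex_of_real (sqrt (1 / a)) * f (- x / a + 1 / a * t))) \<xi>
      = \<bar>a\<bar> *\<^sub>R (LINT s|lborel. cis (2 * pi * \<omega> * (x + a * s - x)) * (complex_of_real (sqrt (1 / a)) * f (- x / a + 1 / a * (x + a * s)))
          * cis (- (2 * pi * \<xi> * (x + a * s))))"
    unfolding fourier_cis by (rule lborel_integral_real_affine) (use a in simp)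
  also have "\<dots> = complex_of_real a * (LINT s|lborel. (cis (- (2 * pi * x * \<xi>)) * complex_of_real (sqrt (1 / a)))
      * (f s * cis (- (2 * pi * (- (a * \<omega>) + a * \<xi>) * s))))"
  proof -
    have "cis (2 * pi * \<omega> * (x + a * s - x)) * (complex_of_real (sqrt (1 / a)) * f (- x / a + 1 / a * (x + a * s)))
          * cis (- (2 * pi * \<xi> * (x + a * s)))
        = complex_of_real (sqrt (1 / a)) * f s * (cis (2 * pi * \<omega> * (x + a * s - x)) * cis (- (2 * pi * \<xi> * (x + a * s))))" for s
      unfolding arg by (simp only: mult_ac)
    also have "\<dots> s = (cis (- (2 * pi * x * \<xi>)) * complex_of_real (sqrt (1 / a)))
        * (f s * cis (- (2 * pi * (- (a * \<omega>) + a * \<xi>) * s)))" for s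
      unfolding cis_sum by (simp only: mult_ac)
    finally show ?thesis using a by (simp only: scaleR_conv_of_real abs_of_pos)
  qed
  also have "\<dots> = cis (- (2 * pi * x * \<xi>)) * (complex_of_real (a * sqrt (1 / a)) * fourier f (- (a * \<omega>) + a * \<xi>))"
    unfolding fourier_cis[of f] integral_mult_right_zero by (simp only: of_real_mult mult_ac)
  finally show ?thesis unfolding sq .
qed

lemma alpha_scale_pos [simp]: "0 < alpha_scale \<alpha> \<omega>"
  by (simp add: alpha_scale_def add_pos_nonneg)

lemma alpha_scale_nonzero [simp]: "alpha_scale \<alpha> \<omega> \<noteq> 0"
  by (metis alpha_scale_pos less_irrefl)

lemma alpha_scale_measurable [measurable]: "alpha_scale \<alpha> \<in> borel_measurable borel"
  unfolding alpha_scale_def[abs_def] by measurable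

lemma alpha_atom_eq:
  "alpha_atom \<alpha> \<psi> (x, \<omega>) = (\<lambda>t. cis (2 * pi * \<omega> * (t - x)) *
     (complex_of_real (sqrt (1 / alpha_scale \<alpha> \<omega>)) * \<psi> (- x / alpha_scale \<alpha> \<omega> + 1 / alpha_scale \<alpha> \<omega> * t)))"
proof
  fix t
  let ?a = "alpha_scale \<alpha> \<omega>"
  have r: "?a powr (- 1 / 2) = sqrt (1 / ?a)"
    using less_imp_le[OF alpha_scale_pos] by (simp add: powr_minus_divide powr_half_sqrt real_sqrt_divide)
  \<comment> \<open>In \<open>dilation\<close> the scale is coerced before the power is taken, so
    this is the complex \<open>powr\<close>; on a positive base it agrees with the real one.\<close>
  have "complex_of_real ?a powr (- 1 / 2) = complex_of_real (sqrt (1 / ?a))"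
    using powr_of_real[of ?a "- 1 / 2"] less_imp_le[OF alpha_scale_pos] unfolding r by simp
  moreover have "(t - x) / ?a = - x / ?a + 1 / ?a * t" by (simp add: diff_divide_distrib)
  moreover have "exp (2 * complex_of_real pi * \<i> * complex_of_real \<omega> * complex_of_real (t - x)) = cis (2 * pi * \<omega> * (t - x))"
    by (simp add: cis_conv_exp algebra_simps)
  ultimately show "alpha_atom \<alpha> \<psi> (x, \<omega>) t = cis (2 * pi * \<omega> * (t - x)) *
     (complex_of_real (sqrt (1 / alpha_scale \<alpha> \<omega>)) * \<psi> (- x / alpha_scale \<alpha> \<omega> + 1 / alpha_scale \<alpha> \<omega> * t))"
    by (simp add: alpha_atom_def translation_def modulation_def dilation_def)
qed

text \<open>The transform of \<open>h = M\<^sub>\<omega> D\<^sub>\<beta> \<psi>\<close>, the atom at \<open>x = 0\<close>.\<close>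

definition atom_hat :: "real \<Rightarrow> (real \<Rightarrow> complex) \<Rightarrow> real \<Rightarrow> real \<Rightarrow> complex" where
  "atom_hat \<alpha> \<psi>_hat \<omega> \<xi> = complex_of_real (sqrt (alpha_scale \<alpha> \<omega>)) * \<psi>_hat (alpha_scale \<alpha> \<omega> * (\<xi> - \<omega>))"

lemma has_L2_fourier_alpha_atom:
  assumes "has_L2_fourier \<psi> \<psi>_hat"
  shows "has_L2_fourier (alpha_atom \<alpha> \<psi> (x, \<omega>)) (\<lambda>\<xi>. cis (- (2 * pi * x * \<xi>)) * atom_hat \<alpha> \<psi>_hat \<omega> \<xi>)"
proof -
  obtain F where F: "\<And>n. integrable lborel (F n)" "L2_tendsto F \<psi>" "L2_tendsto (\<lambda>n. fourier (F n)) \<psi>_hat"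
    using assms unfolding has_L2_fourier_def by blast
  let ?a = "alpha_scale \<alpha> \<omega>"
  let ?U = "\<lambda>f t. cis (2 * pi * \<omega> * (t - x)) * (complex_of_real (sqrt (1 / ?a)) * f (- x / ?a + 1 / ?a * t))"
  have h: "atom_hat \<alpha> \<psi>_hat \<omega> \<xi> = complex_of_real (sqrt ?a) * \<psi>_hat (- (?a * \<omega>) + ?a * \<xi>)" for \<xi>
    by (simp add: atom_hat_def right_diff_distrib)
  have a: "?a > 0" "1 / ?a > 0" by simp_all
  have int: "integrable lborel (?U (F n))" for n
  proof -
    have "integrable lborel (\<lambda>t. complex_of_real (sqrt (1 / ?a)) * F n (- x / ?a + 1 / ?a * t))"
      by (intro integrable_mult_right lborel_integrable_real_affine F) (use a in auto)
    from integrable_mult_unimodular[OF this, of "\<lambda>t. cis (2 * pi * \<omega> * (t - x))"]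
    show ?thesis by (simp add: mult.commute)
  qed
  have t1: "L2_tendsto (\<lambda>n. ?U (F n)) (?U \<psi>)"
    by (rule L2_tendsto_affine[OF F(2) a(2)]) auto
  have "L2_tendsto (\<lambda>n \<xi>. cis (- (2 * pi * x * \<xi>)) * (complex_of_real (sqrt ?a) * fourier (F n) (- (?a * \<omega>) + ?a * \<xi>)))
     (\<lambda>\<xi>. cis (- (2 * pi * x * \<xi>)) * atom_hat \<alpha> \<psi>_hat \<omega> \<xi>)"
    unfolding h by (rule L2_tendsto_affine[OF F(3) a(1)]) auto
  moreover have "fourier (?U (F n)) = (\<lambda>\<xi>. cis (- (2 * pi * x * \<xi>)) * (complex_of_real (sqrt ?a) * fourier (F n) (- (?a * \<omega>) + ?a * \<xi>)))" for n
    by (rule ext, rule fourier_affine[OF a(1)])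
  ultimately have t2: "L2_tendsto (\<lambda>n. fourier (?U (F n))) (\<lambda>\<xi>. cis (- (2 * pi * x * \<xi>)) * atom_hat \<alpha> \<psi>_hat \<omega> \<xi>)"
    by (simp only:)
  show ?thesis
    unfolding has_L2_fourier_def alpha_atom_eq
    by (rule exI[of _ "\<lambda>n. ?U (F n)"]) (intro conjI allI int t1 t2)
qed

section \<open>Fourier multipliers as bounded operators\<close>

text \<open>The transform is a relation, so both a transform of \<open>f\<close> and a preimage
  \<open>h\<close> have to be chosen; for bounded measurable \<open>m\<close> all choices of
  \<open>h\<close> agree up to null sets.\<close>

definition fourier_multiplier :: "(real \<Rightarrow> real) \<Rightarrow> (real \<Rightarrow> complex) \<Rightarrow> real \<Rightarrow> complex" where
  "fourier_multiplier m f = (SOME h. \<exists>f'. has_L2_fourier f f' \<and> has_L2_fourier h (\<lambda>\<xi>. complex_of_real (m \<xi>) * f' \<xi>))"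

lemma L2_mult_bounded:
  assumes "f \<in> L2" "m \<in> borel_measurable borel" "\<And>\<xi>. norm (m \<xi>) \<le> K"
  shows "(\<lambda>\<xi>. m \<xi> * f \<xi>) \<in> L2"
  by (rule L2_dominated[OF assms(1), of _ K])
     (use assms L2_measurable[OF assms(1)] in \<open>auto simp: norm_mult intro!: mult_right_mono\<close>)

text \<open>The transform hidden in the choice need not be the given \<open>f'\<close> but agrees
  with it almost everywhere; surjectivity guarantees that there is something to choose.\<close>

lemma has_L2_fourier_multiplier:
  assumes m: "m \<in> borel_measurable borel" "\<And>\<xi>. \<bar>m \<xi>\<bar> \<le> K" and f: "has_L2_fourier f f'"
  shows "has_L2_fourier (fourier_multiplier m f) (\<lambda>\<xi>. complex_of_real (m \<xi>) * f' \<xi>)"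
proof -
  note [measurable] = m(1) L2_measurable[OF has_L2_fourierD(2)[OF f]]
  have "(\<lambda>\<xi>. complex_of_real (m \<xi>) * f' \<xi>) \<in> L2"
    by (rule L2_mult_bounded[OF has_L2_fourierD(2)[OF f], of _ K]) (use m in auto)
  then obtain h where "has_L2_fourier h (\<lambda>\<xi>. complex_of_real (m \<xi>) * f' \<xi>)" by (rule has_L2_fourier_surj)
  with f have "\<exists>h f'. has_L2_fourier f f' \<and> has_L2_fourier h (\<lambda>\<xi>. complex_of_real (m \<xi>) * f' \<xi>)" by blast
  from someI_ex[OF this] obtain f'' where f'': "has_L2_fourier f f''"
    "has_L2_fourier (fourier_multiplier m f) (\<lambda>\<xi>. complex_of_real (m \<xi>) * f'' \<xi>)"
    unfolding fourier_multiplier_def by blast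
  have "AE \<xi> in lborel. f'' \<xi> = f' \<xi>"
    using has_L2_fourier_AE_eq_iff[OF f''(1) f] by simp
  then have "AE \<xi> in lborel. complex_of_real (m \<xi>) * f'' \<xi> = complex_of_real (m \<xi>) * f' \<xi>"
    by eventually_elim simp
  then show ?thesis by (intro has_L2_fourier_cong_AE[OF f''(2)]) measurable
qed

text \<open>Everything is read off in frequency, where the operator is pointwise multiplication, and
  carried back by \<open>has_L2_fourier_AE_eq_iff\<close> and Plancherel.\<close>

lemma L2_bounded_operator_fourier_multiplier:
  assumes m: "m \<in> borel_measurable borel" "\<And>\<xi>. \<bar>m \<xi>\<bar> \<le> K"
  shows "L2_bounded_operator (fourier_multiplier m)"
  unfolding L2_bounded_operator_def
proof (intro conjI ballI allI)
  note fm = has_L2_fourier_multiplier[OF m]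
  have K: "0 \<le> K" using order_trans[OF abs_ge_zero m(2)] .
  fix f assume "f \<in> L2"
  then obtain f' where f: "has_L2_fourier f f'" by (rule has_L2_fourier_exists)
  show "fourier_multiplier m f \<in> L2" by (rule has_L2_fourierD(1)[OF fm[OF f]])
  fix c
  have "AE t in lborel. fourier_multiplier m (\<lambda>s. c * f s) t = c * fourier_multiplier m f t"
    by (subst has_L2_fourier_AE_eq_iff[OF fm[OF has_L2_fourier_cmult[OF f]] has_L2_fourier_cmult[OF fm[OF f]]]) simp
  then show "AE t in lborel. fourier_multiplier m (\<lambda>s. c * f s) t = c * fourier_multiplier m f t" .
next
  note fm = has_L2_fourier_multiplier[OF m]
  fix f g assume f: "f \<in> L2" and g: "g \<in> L2"
  obtain f' where f: "has_L2_fourier f f'" using f by (rule has_L2_fourier_exists)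
  obtain g' where g: "has_L2_fourier g g'" using g by (rule has_L2_fourier_exists)
  show "AE t in lborel. fourier_multiplier m (\<lambda>s. f s + g s) t = fourier_multiplier m f t + fourier_multiplier m g t"
    by (subst has_L2_fourier_AE_eq_iff[OF fm[OF has_L2_fourier_add[OF f g]] has_L2_fourier_add[OF fm[OF f] fm[OF g]]])
       (simp add: distrib_left)
next
  note fm = has_L2_fourier_multiplier[OF m]
  show "\<exists>K. \<forall>f\<in>L2. L2_norm (fourier_multiplier m f) \<le> K * L2_norm f"
  proof (intro exI ballI)
    fix f assume "f \<in> L2"
    then obtain f' where f: "has_L2_fourier f f'" by (rule has_L2_fourier_exists)
    have "L2_norm (\<lambda>\<xi>. complex_of_real (m \<xi>) * f' \<xi>) \<le> K * L2_norm f'"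
      using m(2) order_trans[OF abs_ge_zero m(2)]
      by (intro L2_norm_mono_AE has_L2_fourierD(2)[OF f] has_L2_fourierD(2)[OF fm[OF f]] AE_I2)
         (auto simp: norm_mult intro: mult_right_mono)
    then show "L2_norm (fourier_multiplier m f) \<le> K * L2_norm f"
      by (simp add: plancherel[OF f] plancherel[OF fm[OF f]])
  qed
qed

lemma fourier_multiplier_inverse:
  assumes m: "m \<in> borel_measurable borel" "\<And>\<xi>. \<bar>m \<xi>\<bar> \<le> K"
    and k: "k \<in> borel_measurable borel" "\<And>\<xi>. \<bar>k \<xi>\<bar> \<le> L"
    and "\<And>\<xi>. k \<xi> * m \<xi> = 1" and "f \<in> L2"
  shows "AE t in lborel. fourier_multiplier k (fourier_multiplier m f) t = f t"
proof -
  obtain f' where f: "has_L2_fourier f f'" using \<open>f \<in> L2\<close> by (rule has_L2_fourier_exists)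
  have "complex_of_real (k \<xi>) * (complex_of_real (m \<xi>) * f' \<xi>) = f' \<xi>" for \<xi>
    using assms(5)[of \<xi>] by (simp flip: mult.assoc of_real_mult)
  then show ?thesis
    using has_L2_fourier_AE_eq_iff[OF has_L2_fourier_multiplier[OF k has_L2_fourier_multiplier[OF m f]] f] by simp
qed

lemma L2_boundedly_invertible_fourier_multiplier:
  assumes m: "m \<in> borel_measurable borel" "\<And>\<xi>. A \<le> m \<xi>" "\<And>\<xi>. m \<xi> \<le> B" and "A > 0"
  shows "L2_boundedly_invertible (fourier_multiplier m)"
proof -
  let ?k = "\<lambda>\<xi>. 1 / m \<xi>"
  have pos: "0 < m \<xi>" for \<xi> using m(2)[of \<xi>] assms(4) by linarith
  have mb: "\<bar>m \<xi>\<bar> \<le> B" for \<xi> using pos[of \<xi>] m(3)[of \<xi>] by simp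
  have k: "?k \<in> borel_measurable borel" using m(1) by measurable
  have kb: "\<bar>?k \<xi>\<bar> \<le> 1 / A" for \<xi> using pos[of \<xi>] m(2)[of \<xi>] assms(4) by (simp add: frac_le)
  have inv: "?k \<xi> * m \<xi> = 1" "m \<xi> * ?k \<xi> = 1" for \<xi> using pos[of \<xi>] by simp_all
  show ?thesis
    unfolding L2_boundedly_invertible_def
  proof (rule exI[of _ "fourier_multiplier ?k"], intro conjI ballI)
    show "L2_bounded_operator (fourier_multiplier ?k)" by (rule L2_bounded_operator_fourier_multiplier[OF k kb])
    fix f assume f: "f \<in> L2"
    show "AE t in lborel. fourier_multiplier ?k (fourier_multiplier m f) t = f t"
      by (rule fourier_multiplier_inverse[OF m(1) mb k kb inv(1) f])
    show "AE t in lborel. fourier_multiplier m (fourier_multiplier ?k f) t = f t"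
      by (rule fourier_multiplier_inverse[OF k kb m(1) mb inv(2) f])
  qed
qed

section \<open>The weak frame operator is a Fourier multiplier\<close>

text \<open>This is the symbol \<open>m_\<psi>\<close>: the square root in \<open>atom_hat\<close>
  squares to the weight \<beta>(\<omega>).\<close>

definition alpha_symbol :: "real \<Rightarrow> (real \<Rightarrow> complex) \<Rightarrow> real \<Rightarrow> real" where
  "alpha_symbol \<alpha> \<psi>_hat \<xi> = (LINT \<omega>|lborel. (norm (atom_hat \<alpha> \<psi>_hat \<omega> \<xi>))\<^sup>2)"

lemma atom_hat_measurable_pair:
  assumes [measurable]: "\<psi>_hat \<in> borel_measurable borel"
  shows "(\<lambda>(\<xi>, \<omega>). atom_hat \<alpha> \<psi>_hat \<omega> \<xi>) \<in> borel_measurable (borel \<Otimes>\<^sub>M borel)"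
  unfolding atom_hat_def by measurable

lemma alpha_symbol_measurable:
  assumes [measurable]: "\<psi>_hat \<in> borel_measurable borel"
  shows "alpha_symbol \<alpha> \<psi>_hat \<in> borel_measurable borel"
  unfolding alpha_symbol_def[abs_def] atom_hat_def by measurable

lemma atom_hat_bound:
  assumes "\<And>v. norm (\<psi>_hat v) \<le> C"
  shows "norm (atom_hat \<alpha> \<psi>_hat \<omega> \<xi>) \<le> sqrt (alpha_scale \<alpha> \<omega>) * C"
  unfolding atom_hat_def norm_mult by (intro mult_mono assms) (auto intro: less_imp_le)

text \<open>For fixed \<open>\<omega>\<close>, the map \<open>x \<mapsto> \<langle>f, T\<^sub>x h\<rangle>\<close> is, up to reflection, the Fourier transform
  of the product of \<open>f_hat\<close> with the conjugate of \<open>h_hat\<close>, which is integrable and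
  square integrable since \<open>h_hat\<close> is bounded.\<close>

context
  fixes \<alpha> C :: real and \<psi> \<psi>_hat :: "real \<Rightarrow> complex"
  assumes \<psi>: "has_L2_fourier \<psi> \<psi>_hat" and C: "\<And>v. norm (\<psi>_hat v) \<le> C"
begin

private definition "slice f' \<omega> \<xi> = f' \<xi> * cnj (atom_hat \<alpha> \<psi>_hat \<omega> \<xi>)" for f' :: "real \<Rightarrow> complex" and \<omega> \<xi>

private lemma \<psi>_hat_measurable [measurable]: "\<psi>_hat \<in> borel_measurable borel"
  by (rule L2_measurable[OF has_L2_fourierD(2)[OF \<psi>]])

private lemma slice_L2:
  assumes "has_L2_fourier f f'"
  shows "slice f' \<omega> \<in> L2" "integrable lborel (slice f' \<omega>)"
proof -
  note L = has_L2_fourierD(2)[OF assms]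
  have h: "(\<lambda>\<xi>. atom_hat \<alpha> \<psi>_hat \<omega> \<xi>) \<in> L2"
    using has_L2_fourierD(2)[OF has_L2_fourier_alpha_atom[OF \<psi>, of \<alpha> 0 \<omega>]] by simp
  show "integrable lborel (slice f' \<omega>)"
    unfolding slice_def[abs_def] by (rule L2_inner_integrable[OF L h])
  have "(\<lambda>\<xi>. cnj (atom_hat \<alpha> \<psi>_hat \<omega> \<xi>) * f' \<xi>) \<in> L2"
    by (rule L2_mult_bounded[OF L]) (use L2_measurable[OF h] atom_hat_bound[OF C] in auto)
  then show "slice f' \<omega> \<in> L2"
    by (simp add: slice_def[abs_def] mult.commute)
qed

private lemma inner_atom_eq:
  assumes "has_L2_fourier f f'"
  shows "L2_inner f (alpha_atom \<alpha> \<psi> (x, \<omega>)) = fourier (slice f' \<omega>) (- x)"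
proof -
  have "L2_inner f (alpha_atom \<alpha> \<psi> (x, \<omega>)) = L2_inner f' (\<lambda>\<xi>. cis (- (2 * pi * x * \<xi>)) * atom_hat \<alpha> \<psi>_hat \<omega> \<xi>)"
    by (rule parseval[OF assms has_L2_fourier_alpha_atom[OF \<psi>], symmetric])
  also have "\<dots> = fourier (slice f' \<omega>) (- x)"
    unfolding L2_inner_def fourier_cis slice_def by (simp add: cis_cnj mult_ac)
  finally show ?thesis .
qed

text \<open>Both coefficient functions of \<open>x\<close> are reflected transforms of slices. The
  substitution of \<open>- x\<close> for \<open>x\<close> undoes the reflection, and Parseval leaves
  the product of the slices themselves, free of \<open>x\<close>.\<close>

private lemma slice_inner:
  assumes f: "has_L2_fourier f f'" and g: "has_L2_fourier g g'"
  shows "(LINT x|lborel. L2_inner f (alpha_atom \<alpha> \<psi> (x, \<omega>)) * cnj (L2_inner g (alpha_atom \<alpha> \<psi> (x, \<omega>))))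
    = (LINT \<xi>|lborel. f' \<xi> * cnj (g' \<xi>) * complex_of_real ((norm (atom_hat \<alpha> \<psi>_hat \<omega> \<xi>))\<^sup>2))"
proof -
  have "(LINT x|lborel. fourier (slice f' \<omega>) (- x) * cnj (fourier (slice g' \<omega>) (- x)))
      = L2_inner (fourier (slice f' \<omega>)) (fourier (slice g' \<omega>))"
    unfolding L2_inner_def by (subst (2) lborel_integral_real_affine[where c = "-1" and t = 0]) simp_all
  also have "\<dots> = L2_inner (slice f' \<omega>) (slice g' \<omega>)"
    by (rule parseval[OF has_L2_fourier_integrable has_L2_fourier_integrable]; rule slice_L2[OF f] slice_L2[OF g])
  also have "\<dots> = (LINT \<xi>|lborel. f' \<xi> * cnj (g' \<xi>) * complex_of_real ((norm (atom_hat \<alpha> \<psi>_hat \<omega> \<xi>))\<^sup>2))"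
    unfolding L2_inner_def slice_def
    by (intro Bochner_Integration.integral_cong refl) (simp add: complex_norm_square del: of_real_power)
  finally show ?thesis unfolding inner_atom_eq[OF f] inner_atom_eq[OF g] .
qed

private lemma inner_atom_L2:
  assumes f: "has_L2_fourier f f'"
  shows "(\<lambda>x. L2_inner f (alpha_atom \<alpha> \<psi> (x, \<omega>))) \<in> L2"
proof -
  have "integrable lborel (\<lambda>x. (norm (fourier (slice f' \<omega>) (0 + (-1) * x)))\<^sup>2)"
    by (rule lborel_integrable_real_affine[OF L2_integrable_sq[OF fourier_contraction(1)[OF slice_L2(2,1)[OF f]]]]) simp
  moreover have "(\<lambda>x. fourier (slice f' \<omega>) (- x)) \<in> borel_measurable borel"
    using fourier_measurable[OF slice_L2(2)[OF f]] by measurable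
  ultimately show ?thesis unfolding inner_atom_eq[OF f] by (intro L2I) simp_all
qed

private lemma inner_atom_measurable_pair:
  assumes "has_L2_fourier f f'"
  shows "(\<lambda>p. L2_inner f (alpha_atom \<alpha> \<psi> p)) \<in> borel_measurable (borel \<Otimes>\<^sub>M borel)"
proof -
  note [measurable] = L2_measurable[OF has_L2_fourierD(1)[OF assms]] L2_measurable[OF has_L2_fourierD(1)[OF \<psi>]]
  have "(\<lambda>p. L2_inner f (alpha_atom \<alpha> \<psi> (fst p, snd p))) \<in> borel_measurable (borel \<Otimes>\<^sub>M borel)"
    unfolding alpha_atom_eq L2_inner_def by measurable
  then show ?thesis by simp
qed

text \<open>Tonelli twice. With \<open>x\<close> inside, Plancherel moves each slice to frequency;
  after the second exchange the integral over \<omega> is the symbol, which is at most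
  \<open>B\<close>. All integrands are nonnegative, so nothing about the plane has to be known
  beforehand.\<close>

private lemma inner_atom_sq_integrable:
  assumes f: "has_L2_fourier f f'"
    and int: "\<And>\<xi>. integrable lborel (\<lambda>\<omega>. (norm (atom_hat \<alpha> \<psi>_hat \<omega> \<xi>))\<^sup>2)"
    and B: "\<And>\<xi>. alpha_symbol \<alpha> \<psi>_hat \<xi> \<le> B"
  shows "integrable (lborel \<Otimes>\<^sub>M lborel) (\<lambda>p. (norm (L2_inner f (alpha_atom \<alpha> \<psi> p)))\<^sup>2)"
proof (rule integrableI_nonneg)
  note [measurable] = inner_atom_measurable_pair[OF f] L2_measurable[OF has_L2_fourierD(2)[OF f]] atom_hat_measurable_pair
  let ?V = "\<lambda>p. L2_inner f (alpha_atom \<alpha> \<psi> p)"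
  show "(\<lambda>p. (norm (?V p))\<^sup>2) \<in> borel_measurable (lborel \<Otimes>\<^sub>M lborel)" by measurable
  have B0: "0 \<le> B" using order_trans[OF _ B] by (simp add: alpha_symbol_def Bochner_Integration.integral_nonneg)
  have slice: "(\<integral>\<^sup>+x. ennreal ((norm (?V (x, \<omega>)))\<^sup>2) \<partial>lborel)
      = (\<integral>\<^sup>+\<xi>. ennreal ((norm (f' \<xi>))\<^sup>2 * (norm (atom_hat \<alpha> \<psi>_hat \<omega> \<xi>))\<^sup>2) \<partial>lborel)" for \<omega>
  proof -
    have i: "integrable lborel (\<lambda>\<xi>. (norm (f' \<xi>))\<^sup>2 * (norm (atom_hat \<alpha> \<psi>_hat \<omega> \<xi>))\<^sup>2)"
      using L2_integrable_sq[OF slice_L2(1)[OF f, of \<omega>]] by (simp add: slice_def norm_mult power_mult_distrib)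
    \<comment> \<open>The slice identity with \<open>g = f\<close>; it is an identity of complex
      numbers whose two sides are real.\<close>
    have "complex_of_real (LINT x|lborel. (norm (?V (x, \<omega>)))\<^sup>2) = (LINT x|lborel. ?V (x, \<omega>) * cnj (?V (x, \<omega>)))"
      by (subst integral_complex_of_real[symmetric]) (simp only: complex_norm_square)
    also have "\<dots> = (LINT \<xi>|lborel. complex_of_real ((norm (f' \<xi>))\<^sup>2 * (norm (atom_hat \<alpha> \<psi>_hat \<omega> \<xi>))\<^sup>2))"
      unfolding slice_inner[OF f f] by (simp only: complex_norm_square[symmetric] of_real_mult)
    also have "\<dots> = complex_of_real (LINT \<xi>|lborel. (norm (f' \<xi>))\<^sup>2 * (norm (atom_hat \<alpha> \<psi>_hat \<omega> \<xi>))\<^sup>2)"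
      by (rule integral_complex_of_real)
    finally have "(LINT x|lborel. (norm (?V (x, \<omega>)))\<^sup>2) = (LINT \<xi>|lborel. (norm (f' \<xi>))\<^sup>2 * (norm (atom_hat \<alpha> \<psi>_hat \<omega> \<xi>))\<^sup>2)"
      unfolding of_real_eq_iff .
    moreover have "(\<integral>\<^sup>+x. ennreal ((norm (?V (x, \<omega>)))\<^sup>2) \<partial>lborel) = ennreal (LINT x|lborel. (norm (?V (x, \<omega>)))\<^sup>2)"
      by (rule nn_integral_eq_integral[OF L2_integrable_sq[OF inner_atom_L2[OF f]]]) simp
    moreover have "(\<integral>\<^sup>+\<xi>. ennreal ((norm (f' \<xi>))\<^sup>2 * (norm (atom_hat \<alpha> \<psi>_hat \<omega> \<xi>))\<^sup>2) \<partial>lborel)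
        = ennreal (LINT \<xi>|lborel. (norm (f' \<xi>))\<^sup>2 * (norm (atom_hat \<alpha> \<psi>_hat \<omega> \<xi>))\<^sup>2)"
      by (rule nn_integral_eq_integral[OF i]) simp
    ultimately show ?thesis by simp
  qed
  have "(\<integral>\<^sup>+p. ennreal ((norm (?V p))\<^sup>2) \<partial>(lborel \<Otimes>\<^sub>M lborel))
      = (\<integral>\<^sup>+\<omega>. \<integral>\<^sup>+x. ennreal ((norm (?V (x, \<omega>)))\<^sup>2) \<partial>lborel \<partial>lborel)"
    by (rule lborel_pair.nn_integral_snd[symmetric]) measurable
  also have "\<dots> = (\<integral>\<^sup>+\<omega>. \<integral>\<^sup>+\<xi>. ennreal ((norm (f' \<xi>))\<^sup>2 * (norm (atom_hat \<alpha> \<psi>_hat \<omega> \<xi>))\<^sup>2) \<partial>lborel \<partial>lborel)"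
    unfolding slice ..
  also have "\<dots> = (\<integral>\<^sup>+\<xi>. \<integral>\<^sup>+\<omega>. ennreal ((norm (f' \<xi>))\<^sup>2 * (norm (atom_hat \<alpha> \<psi>_hat \<omega> \<xi>))\<^sup>2) \<partial>lborel \<partial>lborel)"
    by (rule lborel_pair.Fubini'[symmetric]) measurable
  also have "\<dots> \<le> (\<integral>\<^sup>+\<xi>. ennreal (B * (norm (f' \<xi>))\<^sup>2) \<partial>lborel)"
  proof (rule nn_integral_mono)
    fix \<xi>
    have "(\<integral>\<^sup>+\<omega>. ennreal ((norm (f' \<xi>))\<^sup>2 * (norm (atom_hat \<alpha> \<psi>_hat \<omega> \<xi>))\<^sup>2) \<partial>lborel)
        = ennreal (LINT \<omega>|lborel. (norm (f' \<xi>))\<^sup>2 * (norm (atom_hat \<alpha> \<psi>_hat \<omega> \<xi>))\<^sup>2)"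
      by (rule nn_integral_eq_integral) (use int[of \<xi>] in auto)
    also have "\<dots> = ennreal (alpha_symbol \<alpha> \<psi>_hat \<xi> * (norm (f' \<xi>))\<^sup>2)"
      by (simp add: alpha_symbol_def mult.commute)
    also have "\<dots> \<le> ennreal (B * (norm (f' \<xi>))\<^sup>2)"
      by (intro ennreal_leI mult_right_mono B) simp
    finally show "(\<integral>\<^sup>+\<omega>. ennreal ((norm (f' \<xi>))\<^sup>2 * (norm (atom_hat \<alpha> \<psi>_hat \<omega> \<xi>))\<^sup>2) \<partial>lborel)
        \<le> ennreal (B * (norm (f' \<xi>))\<^sup>2)" .
  qed
  also have "\<dots> = ennreal (LINT \<xi>|lborel. B * (norm (f' \<xi>))\<^sup>2)"
    by (rule nn_integral_eq_integral) (use L2_integrable_sq[OF has_L2_fourierD(2)[OF f]] B0 in auto)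
  finally show "(\<integral>\<^sup>+p. ennreal ((norm (?V p))\<^sup>2) \<partial>(lborel \<Otimes>\<^sub>M lborel)) < \<infinity>"
    by (rule order.strict_trans1) simp
qed simp

text \<open>Square integrability of both coefficient functions gives absolute convergence on the
  plane. The integral over \<open>x\<close> is taken innermost, as \<open>slice_inner\<close> works
  at fixed \<omega>; exchanging \<omega> with \<xi> then produces the symbol.\<close>

lemma weak_frame_operator_fourier_multiplier:
  assumes int: "\<And>\<xi>. integrable lborel (\<lambda>\<omega>. (norm (atom_hat \<alpha> \<psi>_hat \<omega> \<xi>))\<^sup>2)"
    and B: "\<And>\<xi>. alpha_symbol \<alpha> \<psi>_hat \<xi> \<le> B"
  shows "weak_frame_operator \<alpha> \<psi> (fourier_multiplier (alpha_symbol \<alpha> \<psi>_hat))"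
  unfolding weak_frame_operator_def
proof (intro ballI)
  fix f g assume fL: "f \<in> L2" and gL: "g \<in> L2"
  obtain f' where f: "has_L2_fourier f f'" using fL by (rule has_L2_fourier_exists)
  obtain g' where g: "has_L2_fourier g g'" using gL by (rule has_L2_fourier_exists)
  note f'L = has_L2_fourierD(2)[OF f] and g'L = has_L2_fourierD(2)[OF g]
  note [measurable] = inner_atom_measurable_pair[OF f] inner_atom_measurable_pair[OF g]
    L2_measurable[OF f'L] L2_measurable[OF g'L] atom_hat_measurable_pair alpha_symbol_measurable
  let ?m = "alpha_symbol \<alpha> \<psi>_hat"
  let ?V = "\<lambda>f p. L2_inner f (alpha_atom \<alpha> \<psi> p)"
  let ?H = "\<lambda>\<xi> \<omega>. f' \<xi> * cnj (g' \<xi>) * complex_of_real ((norm (atom_hat \<alpha> \<psi>_hat \<omega> \<xi>))\<^sup>2)"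
  have m0: "0 \<le> ?m \<xi>" for \<xi> by (simp add: alpha_symbol_def Bochner_Integration.integral_nonneg)
  then have mb: "\<bar>?m \<xi>\<bar> \<le> B" for \<xi> using B[of \<xi>] by simp
  have flip: "L2_inner (alpha_atom \<alpha> \<psi> p) g = cnj (?V g p)" for p
    unfolding L2_inner_def by (simp flip: Bochner_Integration.integral_cnj add: mult.commute)
  have intV: "integrable (lborel \<Otimes>\<^sub>M lborel) (\<lambda>p. ?V f p * cnj (?V g p))"
  proof (rule Bochner_Integration.integrable_bound)
    show "integrable (lborel \<Otimes>\<^sub>M lborel) (\<lambda>p. (norm (?V f p))\<^sup>2 + (norm (?V g p))\<^sup>2)"
      by (intro Bochner_Integration.integrable_add inner_atom_sq_integrable[OF f int B] inner_atom_sq_integrable[OF g int B])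
    have "norm (a * cnj b) \<le> norm ((norm a)\<^sup>2 + (norm b)\<^sup>2)" for a b :: complex
    proof -
      have "0 \<le> norm a * norm b" by simp
      moreover have "2 * (norm a * norm b) \<le> (norm a)\<^sup>2 + (norm b)\<^sup>2"
        using sum_squares_bound[of "norm a" "norm b"] by (simp add: mult.assoc)
      ultimately have "norm a * norm b \<le> (norm a)\<^sup>2 + (norm b)\<^sup>2" by linarith
      then show ?thesis by (simp add: norm_mult)
    qed
    then show "AE p in lborel \<Otimes>\<^sub>M lborel. norm (?V f p * cnj (?V g p)) \<le> norm ((norm (?V f p))\<^sup>2 + (norm (?V g p))\<^sup>2)"
      by simp
  qed measurable
  \<comment> \<open>Integrating the modulus over \<omega> gives the symbol times
    \<open>norm (f' \<xi> * cnj (g' \<xi>))\<close>, which is integrable because the symbol is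
    bounded by \<open>B\<close>.\<close>
  have intH: "integrable (lborel \<Otimes>\<^sub>M lborel) (\<lambda>(\<xi>, \<omega>). ?H \<xi> \<omega>)"
  proof (rule lborel_pair.Fubini_integrable)
    have "integrable lborel (\<lambda>\<xi>. complex_of_real (?m \<xi>) * f' \<xi> * cnj (g' \<xi>))"
      by (rule L2_inner_integrable[OF L2_mult_bounded[OF f'L, of _ B] g'L]) (use mb in auto)
    then have "integrable lborel (\<lambda>\<xi>. norm (complex_of_real (?m \<xi>) * f' \<xi> * cnj (g' \<xi>)))"
      by (rule integrable_norm)
    then show "integrable lborel (\<lambda>\<xi>. LINT \<omega>|lborel. norm (case (\<xi>, \<omega>) of (\<xi>, \<omega>) \<Rightarrow> ?H \<xi> \<omega>))"
      by (simp add: norm_mult m0 mult_ac del: of_real_power flip: alpha_symbol_def)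
    show "AE \<xi> in lborel. integrable lborel (\<lambda>\<omega>. case (\<xi>, \<omega>) of (\<xi>, \<omega>) \<Rightarrow> ?H \<xi> \<omega>)"
      using int by (intro AE_I2) (simp del: of_real_power)
  qed measurable
  show "integrable lborel (\<lambda>p. L2_inner f (alpha_atom \<alpha> \<psi> p) * L2_inner (alpha_atom \<alpha> \<psi> p) g) \<and>
      L2_inner (fourier_multiplier ?m f) g = (LINT p|lborel. L2_inner f (alpha_atom \<alpha> \<psi> p) * L2_inner (alpha_atom \<alpha> \<psi> p) g)"
    unfolding flip lborel_prod[symmetric]
  proof
    show "integrable (lborel \<Otimes>\<^sub>M lborel) (\<lambda>p. ?V f p * cnj (?V g p))" by (rule intV)
    have "(LINT p|(lborel \<Otimes>\<^sub>M lborel). ?V f p * cnj (?V g p)) = (LINT \<omega>|lborel. LINT x|lborel. ?V f (x, \<omega>) * cnj (?V g (x, \<omega>)))"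
      using lborel_pair.integral_snd[of "\<lambda>x \<omega>. ?V f (x, \<omega>) * cnj (?V g (x, \<omega>))"] intV by (simp add: case_prod_beta')
    also have "\<dots> = (LINT \<omega>|lborel. LINT \<xi>|lborel. ?H \<xi> \<omega>)"
      unfolding slice_inner[OF f g] ..
    also have "\<dots> = (LINT \<xi>|lborel. LINT \<omega>|lborel. ?H \<xi> \<omega>)"
      by (rule lborel_pair.Fubini_integral[OF intH])
    also have "\<dots> = (LINT \<xi>|lborel. complex_of_real (?m \<xi>) * f' \<xi> * cnj (g' \<xi>))"
      unfolding alpha_symbol_def by (simp add: mult_ac del: of_real_power)
    also have "\<dots> = L2_inner (fourier_multiplier ?m f) g"
      unfolding L2_inner_def[symmetric]
      by (rule parseval[OF has_L2_fourier_multiplier[OF alpha_symbol_measurable mb f] g]) measurable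
    finally show "L2_inner (fourier_multiplier ?m f) g = (LINT p|(lborel \<Otimes>\<^sub>M lborel). ?V f p * cnj (?V g p))" ..
  qed
qed

end

section \<open>Bounds for the symbol\<close>

lemma integrable_one_plus_abs_powr:
  fixes s :: real assumes "s > 1" shows "integrable lborel (\<lambda>v::real. (1 + \<bar>v\<bar>) powr (- s))"
proof -
  let ?g = "\<lambda>v::real. (1 + v) powr (- s) * indicator {0..} v"
  have "(\<integral>\<^sup>+v. ennreal ((1 + v) powr (- s)) * indicator {0..} v \<partial>lborel) = ennreal (0 - (- ((1 + 0) powr (1 - s)) / (s - 1)))"
  proof (rule nn_integral_FTC_atLeast)
    fix v :: real assume "0 \<le> v"
    have "((\<lambda>v. - ((1 + v) powr (1 - s)) / (s - 1)) has_real_derivative - ((1 - s) * (1 + v) powr (1 - s - 1)) / (s - 1)) (at v)"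
      using \<open>0 \<le> v\<close> assms by (auto intro!: derivative_eq_intros)
    also have "- ((1 - s) * (1 + v) powr (1 - s - 1)) / (s - 1) = (1 + v) powr (- s)"
      using assms by (simp add: divide_simps) (simp add: algebra_simps)
    finally show "((\<lambda>v. - ((1 + v) powr (1 - s)) / (s - 1)) has_real_derivative (1 + v) powr (- s)) (at v)" .
  next
    have "((\<lambda>v. (1 + v) powr (1 - s)) \<longlongrightarrow> 0) at_top"
      by (rule tendsto_neg_powr) (use assms in \<open>auto intro: filterlim_tendsto_add_at_top filterlim_ident\<close>)
    from tendsto_divide[OF tendsto_minus[OF this] tendsto_const[of "s - 1"]]
    show "((\<lambda>v. - ((1 + v) powr (1 - s)) / (s - 1)) \<longlongrightarrow> 0) at_top" using assms by simp
  qed auto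
  then have "(\<integral>\<^sup>+v. ennreal (?g v) \<partial>lborel) < \<infinity>"
    by (simp add: ennreal_mult' flip: ennreal_indicator)
  then have g: "integrable lborel ?g" by (intro integrableI_nonneg) auto
  \<comment> \<open>Reflection supplies the negative half-line; the origin is counted twice, so the
    sum is only a majorant.\<close>
  have "integrable lborel (\<lambda>v. ?g v + ?g (0 + (-1) * v))"
    by (intro Bochner_Integration.integrable_add lborel_integrable_real_affine g) auto
  then show ?thesis
  proof (rule Bochner_Integration.integrable_bound)
    show "AE v in lborel. norm ((1 + \<bar>v\<bar>) powr (- s)) \<le> norm (?g v + ?g (0 + (-1) * v))"
      by (intro AE_I2) (auto simp: indicator_def)
  qed measurable
qed

text \<open>For \<open>k \<ge> 1\<close> and exponents up to 1 one has
  \<open>k powr \<alpha> \<le> k\<close>, so the comparison factor survives the passage to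
  scales.\<close>

lemma alpha_scale_comparable:
  assumes "0 \<le> \<alpha>" "\<alpha> \<le> 1" "k \<ge> 1" "1 + \<bar>\<omega>\<bar> \<le> k * (1 + \<bar>\<xi>\<bar>)"
  shows "alpha_scale \<alpha> \<xi> \<le> k * alpha_scale \<alpha> \<omega>"
proof -
  have "(1 + \<bar>\<omega>\<bar>) powr \<alpha> \<le> (k * (1 + \<bar>\<xi>\<bar>)) powr \<alpha>"
    by (rule powr_mono2) (use assms in auto)
  also have "\<dots> = k powr \<alpha> * (1 + \<bar>\<xi>\<bar>) powr \<alpha>" using assms by (simp add: powr_mult)
  also have "\<dots> \<le> k * (1 + \<bar>\<xi>\<bar>) powr \<alpha>"
    using powr_mono[of \<alpha> 1 k] assms by (intro mult_right_mono) auto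
  finally have "(1 + \<bar>\<omega>\<bar>) powr \<alpha> \<le> k * (1 + \<bar>\<xi>\<bar>) powr \<alpha>" .
  moreover have "(1 + \<bar>\<omega>\<bar>) powr \<alpha> > 0" "(1 + \<bar>\<xi>\<bar>) powr \<alpha> > 0" by (auto simp: add_pos_nonneg)
  ultimately show ?thesis
    unfolding alpha_scale_def powr_minus by (simp add: field_simps)
qed

lemma norm_atom_hat_sq:
  "(norm (atom_hat \<alpha> \<psi>_hat \<omega> \<xi>))\<^sup>2 = alpha_scale \<alpha> \<omega> * (norm (\<psi>_hat (alpha_scale \<alpha> \<omega> * (\<xi> - \<omega>))))\<^sup>2"
  using less_imp_le[OF alpha_scale_pos] by (simp add: atom_hat_def norm_mult power_mult_distrib)

text \<open>Near \<open>\<xi>\<close> the scale is comparable to the scale at \<open>\<xi>\<close>, which gives the first term;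
  far from \<open>\<xi>\<close> one has \<open>\<bar>\<xi> - \<omega>\<bar> \<ge> (1 + \<bar>\<omega>\<bar>) / 3\<close>, which gives the second.\<close>

lemma alpha_kernel_le:
  assumes \<alpha>: "0 \<le> \<alpha>" "\<alpha> < 1" and s: "s > 1"
  shows "alpha_scale \<alpha> \<omega> * (1 + \<bar>alpha_scale \<alpha> \<omega> * (\<xi> - \<omega>)\<bar>) powr (- s)
    \<le> 2 * alpha_scale \<alpha> \<xi> * (1 + \<bar>- (alpha_scale \<alpha> \<xi> / 2 * \<xi>) + alpha_scale \<alpha> \<xi> / 2 * \<omega>\<bar>) powr (- s)
      + 3 powr s * (1 + \<bar>\<omega>\<bar>) powr (- (s * (1 - \<alpha>) + \<alpha>))"
proof -
  let ?b = "alpha_scale \<alpha> \<xi>" and ?w = "alpha_scale \<alpha> \<omega>"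
  have pos: "0 < ?b" "0 < ?w" by simp_all
  have absw: "\<bar>?w * (\<xi> - \<omega>)\<bar> = ?w * \<bar>\<xi> - \<omega>\<bar>" by (simp only: abs_mult abs_of_pos[OF pos(2)])
  \<comment> \<open>Up to the threshold \<open>(1 + \<bar>\<xi>\<bar>) / 2\<close> the triangle
    inequality makes \<open>1 + \<bar>\<omega>\<bar>\<close> and
    \<open>1 + \<bar>\<xi>\<bar>\<close> comparable within a factor 2. Beyond it
    \<open>1 + \<bar>\<xi>\<bar> < 2 * \<bar>\<xi> - \<omega>\<bar>\<close>, and one more distance
    leads from \<xi> to \<omega>, which explains the 3.\<close>
  show ?thesis
  proof (cases "\<bar>\<xi> - \<omega>\<bar> \<le> (1 + \<bar>\<xi>\<bar>) / 2")
    case True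
    have near: "2 * \<bar>\<xi> - \<omega>\<bar> \<le> 1 + \<bar>\<xi>\<bar>" using True by simp
    have "1 + \<bar>\<xi>\<bar> \<le> 2 * (1 + \<bar>\<omega>\<bar>)" using near by (smt (verit))
    moreover have "1 + \<bar>\<omega>\<bar> \<le> 2 * (1 + \<bar>\<xi>\<bar>)" using near by (smt (verit))
    ultimately have c: "?w \<le> 2 * ?b" "?b \<le> 2 * ?w"
      using alpha_scale_comparable[of \<alpha> 2] \<alpha> by auto
    have "\<bar>- (?b / 2 * \<xi>) + ?b / 2 * \<omega>\<bar> = ?b / 2 * \<bar>\<xi> - \<omega>\<bar>"
    proof -
      have "- (?b / 2 * \<xi>) + ?b / 2 * \<omega> = - (?b / 2 * (\<xi> - \<omega>))" by (simp add: right_diff_distrib)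
      moreover have "\<bar>?b / 2\<bar> = ?b / 2" by (rule abs_of_pos) simp
      ultimately show ?thesis by (simp only: abs_minus_cancel abs_mult)
    qed
    also have "\<dots> \<le> ?w * \<bar>\<xi> - \<omega>\<bar>" using c by (intro mult_right_mono) auto
    finally have "(1 + \<bar>?w * (\<xi> - \<omega>)\<bar>) powr (- s) \<le> (1 + \<bar>- (?b / 2 * \<xi>) + ?b / 2 * \<omega>\<bar>) powr (- s)"
      unfolding absw by (intro powr_mono2') (use s in \<open>auto intro: add_pos_nonneg\<close>)
    then have "?w * (1 + \<bar>?w * (\<xi> - \<omega>)\<bar>) powr (- s) \<le> (2 * ?b) * (1 + \<bar>- (?b / 2 * \<xi>) + ?b / 2 * \<omega>\<bar>) powr (- s)"
      using c pos by (intro mult_mono) auto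
    then show ?thesis by (simp add: add_increasing2)
  next
    case False
    then have "1 + \<bar>\<xi>\<bar> < 2 * \<bar>\<xi> - \<omega>\<bar>" by simp
    then have "1 + \<bar>\<omega>\<bar> \<le> 3 * \<bar>\<xi> - \<omega>\<bar>" by (smt (verit))
    then have "(1 + \<bar>\<omega>\<bar>) / 3 \<le> \<bar>\<xi> - \<omega>\<bar>" by simp
    from mult_left_mono[OF this less_imp_le[OF pos(2)]]
    have "?w * ((1 + \<bar>\<omega>\<bar>) / 3) \<le> 1 + \<bar>?w * (\<xi> - \<omega>)\<bar>"
      unfolding absw by (rule add_increasing[OF zero_le_one])
    moreover have "?w * ((1 + \<bar>\<omega>\<bar>) / 3) = (1 + \<bar>\<omega>\<bar>) powr (1 - \<alpha>) / 3"
      using powr_add[of "1 + \<bar>\<omega>\<bar>" "- \<alpha>" 1] by (simp add: alpha_scale_def)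
    ultimately have "(1 + \<bar>?w * (\<xi> - \<omega>)\<bar>) powr (- s) \<le> ((1 + \<bar>\<omega>\<bar>) powr (1 - \<alpha>) / 3) powr (- s)"
      by (intro powr_mono2') (use s in \<open>auto simp: add_pos_nonneg\<close>)
    also have "\<dots> = 3 powr s * (1 + \<bar>\<omega>\<bar>) powr (- (s * (1 - \<alpha>)))"
      by (simp add: powr_divide powr_powr powr_minus_divide mult.commute)
    finally have "?w * (1 + \<bar>?w * (\<xi> - \<omega>)\<bar>) powr (- s) \<le> ?w * (3 powr s * (1 + \<bar>\<omega>\<bar>) powr (- (s * (1 - \<alpha>))))"
      using less_imp_le[OF pos(2)] by (intro mult_left_mono) auto
    also have "\<dots> = 3 powr s * (1 + \<bar>\<omega>\<bar>) powr (- (s * (1 - \<alpha>) + \<alpha>))"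
      using powr_add[of "1 + \<bar>\<omega>\<bar>" "- (s * (1 - \<alpha>))" "- \<alpha>"] by (simp add: alpha_scale_def)
    finally show ?thesis using less_imp_le[OF pos(1)] by (intro add_increasing) auto
  qed
qed

text \<open>Both terms of \<open>alpha_kernel_le\<close> integrate to constants: the first by an
  affine substitution whose Jacobian cancels the factor \<beta>(\<xi>), the second because it does
  not involve \<xi>.\<close>

lemma alpha_symbol_upper:
  assumes \<alpha>: "0 \<le> \<alpha>" "\<alpha> < 1" and r: "2 * r > 1" and m: "\<psi>_hat \<in> borel_measurable borel"
    and decay: "\<And>v. norm (\<psi>_hat v) \<le> C * (1 + \<bar>v\<bar>) powr (- r)"
  obtains B where "\<And>\<xi>. integrable lborel (\<lambda>\<omega>. (norm (atom_hat \<alpha> \<psi>_hat \<omega> \<xi>))\<^sup>2)"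
    "\<And>\<xi>. alpha_symbol \<alpha> \<psi>_hat \<xi> \<le> B"
proof -
  note [measurable] = m atom_hat_measurable_pair[OF m]
  \<comment> \<open>\<open>s\<close> is the decay exponent after squaring, and
    \<open>q = 1 + (s - 1) * (1 - \<alpha>)\<close>, which exceeds 1 because \<open>s > 1\<close>
    and \<open>\<alpha> < 1\<close>.\<close>
  define s where "s = 2 * r"
  define q where "q = s * (1 - \<alpha>) + \<alpha>"
  have s: "s > 1" using r by (simp add: s_def)
  have "1 * (1 - \<alpha>) < s * (1 - \<alpha>)" by (rule mult_strict_right_mono[OF s]) (use \<alpha> in simp)
  then have "1 - \<alpha> < s * (1 - \<alpha>)" by simp
  then have q: "q > 1" unfolding q_def by linarith
  define I where "I p = (LINT v|lborel. (1 + \<bar>v :: real\<bar>) powr (- p))" for p :: real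
  let ?G1 = "\<lambda>\<xi> \<omega>. (1 + \<bar>- (alpha_scale \<alpha> \<xi> / 2 * \<xi>) + alpha_scale \<alpha> \<xi> / 2 * \<omega>\<bar>) powr (- s)"
  let ?G2 = "\<lambda>\<omega>::real. (1 + \<bar>\<omega>\<bar>) powr (- q)"
  let ?G = "\<lambda>\<xi> \<omega>. C\<^sup>2 * (2 * alpha_scale \<alpha> \<xi> * ?G1 \<xi> \<omega> + 3 powr s * ?G2 \<omega>)"
  have i1: "integrable lborel (?G1 \<xi>)" for \<xi>
    by (rule lborel_integrable_real_affine[OF integrable_one_plus_abs_powr[OF s]]) simp
  have i2: "integrable lborel ?G2" by (rule integrable_one_plus_abs_powr[OF q])
  have I1: "alpha_scale \<alpha> \<xi> * (LINT \<omega>|lborel. ?G1 \<xi> \<omega>) = 2 * I s" for \<xi>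
  proof -
    have "I s = \<bar>alpha_scale \<alpha> \<xi> / 2\<bar> *\<^sub>R (LINT \<omega>|lborel. ?G1 \<xi> \<omega>)"
      unfolding I_def by (rule lborel_integral_real_affine) simp
    moreover have "\<bar>alpha_scale \<alpha> \<xi> / 2\<bar> = alpha_scale \<alpha> \<xi> / 2" by (rule abs_of_pos) simp
    ultimately show ?thesis by simp
  qed
  have G: "integrable lborel (?G \<xi>)" for \<xi> using i1 i2 by simp
  have "(LINT \<omega>|lborel. ?G \<xi> \<omega>) = C\<^sup>2 * (2 * (alpha_scale \<alpha> \<xi> * (LINT \<omega>|lborel. ?G1 \<xi> \<omega>)) + 3 powr s * (LINT \<omega>|lborel. ?G2 \<omega>))" for \<xi>
    using i1[of \<xi>] i2 by (simp add: mult.assoc)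
  then have GI: "(LINT \<omega>|lborel. ?G \<xi> \<omega>) = C\<^sup>2 * (4 * I s + 3 powr s * I q)" for \<xi>
    unfolding I1 I_def by simp
  have le: "(norm (atom_hat \<alpha> \<psi>_hat \<omega> \<xi>))\<^sup>2 \<le> ?G \<xi> \<omega>" for \<xi> \<omega>
  proof -
    let ?v = "alpha_scale \<alpha> \<omega> * (\<xi> - \<omega>)"
    have "(norm (\<psi>_hat ?v))\<^sup>2 \<le> (C * (1 + \<bar>?v\<bar>) powr (- r))\<^sup>2"
      by (intro power_mono decay) simp
    also have "\<dots> = C\<^sup>2 * (1 + \<bar>?v\<bar>) powr (- s)"
      by (simp add: power_mult_distrib s_def power2_eq_square flip: powr_add)
    finally have "(norm (atom_hat \<alpha> \<psi>_hat \<omega> \<xi>))\<^sup>2 \<le> alpha_scale \<alpha> \<omega> * (C\<^sup>2 * (1 + \<bar>?v\<bar>) powr (- s))"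
      unfolding norm_atom_hat_sq by (intro mult_left_mono) (auto intro: less_imp_le)
    also have "\<dots> = C\<^sup>2 * (alpha_scale \<alpha> \<omega> * (1 + \<bar>?v\<bar>) powr (- s))" by simp
    also have "\<dots> \<le> ?G \<xi> \<omega>"
      unfolding q_def by (intro mult_left_mono alpha_kernel_le \<alpha> s) simp
    finally show ?thesis .
  qed
  have int: "integrable lborel (\<lambda>\<omega>. (norm (atom_hat \<alpha> \<psi>_hat \<omega> \<xi>))\<^sup>2)" for \<xi>
  proof (rule Bochner_Integration.integrable_bound[OF G[of \<xi>]])
    show "AE \<omega> in lborel. norm ((norm (atom_hat \<alpha> \<psi>_hat \<omega> \<xi>))\<^sup>2) \<le> norm (?G \<xi> \<omega>)"
    proof (rule AE_I2)
      fix \<omega>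
      show "norm ((norm (atom_hat \<alpha> \<psi>_hat \<omega> \<xi>))\<^sup>2) \<le> norm (?G \<xi> \<omega>)"
        unfolding real_norm_def using le[where \<xi> = \<xi> and \<omega> = \<omega>] by (smt (verit) zero_le_power2)
    qed
  qed (unfold atom_hat_def, measurable)
  have "alpha_symbol \<alpha> \<psi>_hat \<xi> \<le> C\<^sup>2 * (4 * I s + 3 powr s * I q)" for \<xi>
    unfolding alpha_symbol_def GI[of \<xi>, symmetric] by (rule integral_mono[OF int G le])
  with int show ?thesis by (rule that)
qed

section \<open>Range of the frequency map and the lower bound\<close>

text \<open>Intermediate value theorem: the map is continuous in \<omega>, and since
  \<open>\<alpha> < 1\<close> its size grows like
  \<open>\<bar>\<omega>\<bar> powr (1 - \<alpha>)\<close>, with opposite signs at the two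
  ends.\<close>

lemma ex_alpha_scale_mult_eq:
  assumes \<alpha>: "0 \<le> \<alpha>" "\<alpha> < 1"
  obtains \<omega> where "alpha_scale \<alpha> \<omega> * (\<xi> - \<omega>) = v"
proof -
  \<comment> \<open>The term \<open>2 * \<bar>\<xi>\<bar> + 1\<close> ensures
    \<open>T - \<bar>\<xi>\<bar> \<ge> (1 + T) / 2\<close>; the power ensures that half of
    \<open>(1 + T) powr (1 - \<alpha>)\<close> is at least \<open>\<bar>v\<bar>\<close>.\<close>
  define T where "T = 2 * \<bar>\<xi>\<bar> + 1 + (2 * \<bar>v\<bar>) powr (1 / (1 - \<alpha>))"
  have T: "T \<ge> 2 * \<bar>\<xi>\<bar> + 1" by (simp add: T_def)
  let ?\<Phi> = "\<lambda>\<omega>. alpha_scale \<alpha> \<omega> * (\<xi> - \<omega>)"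
  have "2 * \<bar>v\<bar> = ((2 * \<bar>v\<bar>) powr (1 / (1 - \<alpha>))) powr (1 - \<alpha>)"
    using \<alpha> by (simp add: powr_powr)
  also have "\<dots> \<le> (1 + T) powr (1 - \<alpha>)"
    by (rule powr_mono2) (use \<alpha> in \<open>auto simp: T_def\<close>)
  also have "\<dots> = (1 + \<bar>T\<bar>) powr (- \<alpha>) * (1 + T)"
    using T powr_add[of "1 + T" "- \<alpha>" 1] by simp
  finally have v: "\<bar>v\<bar> \<le> (1 + \<bar>T\<bar>) powr (- \<alpha>) * ((1 + T) / 2)" by simp
  have "1 + T \<le> 2 * \<xi> + 2 * T" using T by linarith
  then have "(1 + T) / 2 \<le> \<xi> + T" by simp
  moreover have "1 + T \<le> 2 * T - 2 * \<xi>" using T by linarith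
  then have "(1 + T) / 2 \<le> T - \<xi>" by simp
  ultimately have "(1 + \<bar>T\<bar>) powr (- \<alpha>) * ((1 + T) / 2) \<le> (1 + \<bar>T\<bar>) powr (- \<alpha>) * (\<xi> + T)"
       "(1 + \<bar>T\<bar>) powr (- \<alpha>) * ((1 + T) / 2) \<le> (1 + \<bar>T\<bar>) powr (- \<alpha>) * (T - \<xi>)"
    by (intro mult_left_mono; simp)+
  moreover have "?\<Phi> (- T) = (1 + \<bar>T\<bar>) powr (- \<alpha>) * (\<xi> + T)" "?\<Phi> T = - ((1 + \<bar>T\<bar>) powr (- \<alpha>) * (T - \<xi>))"
    by (simp_all add: alpha_scale_def algebra_simps)
  ultimately have "v \<le> ?\<Phi> (- T)" "?\<Phi> T \<le> v" using v by (simp_all only:)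
  moreover have "continuous_on {-T..T} ?\<Phi>"
    unfolding alpha_scale_def by (intro continuous_intros) auto
  ultimately have "\<exists>\<omega>. - T \<le> \<omega> \<and> \<omega> \<le> T \<and> ?\<Phi> \<omega> = v"
    using T by (intro IVT2') auto
  with that show ?thesis by blast
qed

text \<open>With \<open>\<Phi> \<omega> = \<beta>(\<omega>)(\<xi> - \<omega>)\<close>, write
  \<open>\<Phi> \<omega> - \<Phi> \<omega>\<^sub>0 = \<beta>(\<omega>)(\<omega>\<^sub>0 - \<omega>) + (\<beta>(\<omega>)/\<beta>(\<omega>\<^sub>0) - 1) \<Phi> \<omega>\<^sub>0\<close>; on an interval of length
  proportional to \<open>1/\<beta>(\<omega>\<^sub>0)\<close> both terms are small uniformly in \<open>\<xi>\<close>.\<close>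

lemma alpha_scale_mult_close:
  assumes \<alpha>: "0 \<le> \<alpha>" "\<alpha> < 1" and \<eta>: "0 < \<eta>" "\<eta> \<le> 1/2"
    and eq: "alpha_scale \<alpha> \<omega>0 * (\<xi> - \<omega>0) = v" and close: "\<bar>\<omega> - \<omega>0\<bar> \<le> \<eta> / alpha_scale \<alpha> \<omega>0"
  shows "alpha_scale \<alpha> \<omega>0 \<le> 2 * alpha_scale \<alpha> \<omega>"
    and "\<bar>alpha_scale \<alpha> \<omega> * (\<xi> - \<omega>) - v\<bar> \<le> 2 * \<eta> * (1 + \<bar>v\<bar>)"
proof -
  let ?b = "alpha_scale \<alpha> \<omega>0" and ?w = "alpha_scale \<alpha> \<omega>"
  have pos: "0 < ?b" "0 < ?w" by simp_all
  \<comment> \<open>Since \<beta> is at least \<open>1 / (1 + \<bar>\<omega>0\<bar>)\<close> at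
    \<open>\<omega>0\<close>, closeness on the scale 1/\<beta> is a relative error of at most \<eta>
    in \<open>1 + \<bar>\<omega>0\<bar>\<close>.\<close>
  have "(1 + \<bar>\<omega>0\<bar>) powr \<alpha> \<le> (1 + \<bar>\<omega>0\<bar>) powr 1" by (rule powr_mono) (use \<alpha> in auto)
  then have "1 / ?b \<le> 1 + \<bar>\<omega>0\<bar>" by (simp add: alpha_scale_def powr_minus_divide)
  from mult_left_mono[OF this, of \<eta>] have "\<bar>\<omega> - \<omega>0\<bar> \<le> \<eta> * (1 + \<bar>\<omega>0\<bar>)"
    using close \<eta> by simp
  then have d1': "1 + \<bar>\<omega>\<bar> \<le> (1 + \<eta>) * (1 + \<bar>\<omega>0\<bar>)"
    and d2': "(1 - \<eta>) * (1 + \<bar>\<omega>0\<bar>) \<le> 1 + \<bar>\<omega>\<bar>"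
    by (simp_all only: distrib_right left_diff_distrib mult_1)
  \<comment> \<open>The product is \<open>1 + \<eta> - 2 * \<eta>\<^sup>2\<close>, which is at least
    1 because \<open>\<eta> \<le> 1/2\<close>.\<close>
  have "1 \<le> (1 + 2 * \<eta>) * (1 - \<eta>)"
    using \<eta> mult_left_mono[of \<eta> "1/2" \<eta>] by (simp add: algebra_simps)
  from mult_right_mono[OF this, of "1 + \<bar>\<omega>0\<bar>"]
  have "1 + \<bar>\<omega>0\<bar> \<le> (1 + 2 * \<eta>) * ((1 - \<eta>) * (1 + \<bar>\<omega>0\<bar>))" by (simp add: mult.assoc)
  also have "\<dots> \<le> (1 + 2 * \<eta>) * (1 + \<bar>\<omega>\<bar>)" by (intro mult_left_mono d2') (use \<eta> in simp)
  finally have d1: "1 + \<bar>\<omega>0\<bar> \<le> (1 + 2 * \<eta>) * (1 + \<bar>\<omega>\<bar>)" .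
  have "(1 + \<eta>) * (1 + \<bar>\<omega>0\<bar>) \<le> (1 + 2 * \<eta>) * (1 + \<bar>\<omega>0\<bar>)"
    using \<eta> by (intro mult_right_mono) auto
  with d1' have d2: "1 + \<bar>\<omega>\<bar> \<le> (1 + 2 * \<eta>) * (1 + \<bar>\<omega>0\<bar>)" by linarith
  have bw: "?b \<le> (1 + 2 * \<eta>) * ?w" by (rule alpha_scale_comparable) (use \<alpha> \<eta> d2 in auto)
  have wb: "?w \<le> (1 + 2 * \<eta>) * ?b" by (rule alpha_scale_comparable) (use \<alpha> \<eta> d1 in auto)
  have two: "(1 + 2 * \<eta>) * z \<le> 2 * z" if "z > 0" for z using \<eta> that by (intro mult_right_mono) auto
  show "?b \<le> 2 * ?w" using bw two[OF pos(2)] by linarith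
  have "?w * \<bar>\<omega>0 - \<omega>\<bar> \<le> (2 * ?b) * (\<eta> / ?b)"
  proof (rule mult_mono)
    show "?w \<le> 2 * ?b" using wb two[OF pos(1)] by linarith
    show "\<bar>\<omega>0 - \<omega>\<bar> \<le> \<eta> / ?b" using close by (simp add: abs_minus_commute)
  qed (use less_imp_le[OF pos(1)] in auto)
  then have t1: "\<bar>?w * (\<omega>0 - \<omega>)\<bar> \<le> 2 * \<eta>" by (simp add: abs_mult abs_of_pos[OF pos(2)])
  have "\<bar>?w / ?b - 1\<bar> \<le> 2 * \<eta>"
  proof -
    have "?w / ?b \<le> 1 + 2 * \<eta>" using wb pos by (simp add: field_simps)
    moreover have "1 - 2 * \<eta> \<le> ?w / ?b"
    proof -
      \<comment> \<open>Multiplication by \<open>1 - 2 * \<eta>\<close> takes the place of division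
        by \<open>1 + 2 * \<eta>\<close>, since the product of the two is at most 1.\<close>
      have "(1 - 2 * \<eta>) * ?b \<le> (1 - 2 * \<eta>) * ((1 + 2 * \<eta>) * ?w)"
        using bw \<eta> by (intro mult_left_mono) auto
      also have "\<dots> = (1 - 4 * \<eta>\<^sup>2) * ?w" by (simp add: algebra_simps power2_eq_square)
      also have "\<dots> \<le> 1 * ?w" using less_imp_le[OF pos(2)] by (intro mult_right_mono) auto
      finally show ?thesis using pos by (simp add: field_simps)
    qed
    ultimately show ?thesis by (simp add: abs_le_iff)
  qed
  then have t2: "\<bar>(?w / ?b - 1) * v\<bar> \<le> 2 * \<eta> * \<bar>v\<bar>"
    unfolding abs_mult by (intro mult_right_mono) auto
  have "?w / ?b * v = ?w * (\<xi> - \<omega>0)" using pos unfolding eq[symmetric] by simp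
  then have "?w * (\<xi> - \<omega>) - v = ?w * (\<omega>0 - \<omega>) + (?w / ?b - 1) * v"
    by (simp add: algebra_simps)
  then show "\<bar>?w * (\<xi> - \<omega>) - v\<bar> \<le> 2 * \<eta> * (1 + \<bar>v\<bar>)"
    using t1 t2 abs_triangle_ineq[of "?w * (\<omega>0 - \<omega>)" "(?w / ?b - 1) * v"] by (simp add: algebra_simps)
qed

text \<open>On an interval around \<open>\<omega>0\<close> the integrand is at least
  \<open>c\<^sup>2\<close> times half the scale at \<open>\<omega>0\<close>, and the interval has
  length \<open>2 * \<eta>\<close> divided by that scale. The scale cancels, so
  \<open>c\<^sup>2 * \<eta>\<close> is independent of \<xi> although \<open>\<omega>0\<close> is
  not.\<close>

lemma alpha_symbol_lower:
  assumes \<alpha>: "0 \<le> \<alpha>" "\<alpha> < 1" and cont: "continuous_on UNIV \<psi>_hat" and nz: "\<psi>_hat v \<noteq> 0"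
    and int: "\<And>\<xi>. integrable lborel (\<lambda>\<omega>. (norm (atom_hat \<alpha> \<psi>_hat \<omega> \<xi>))\<^sup>2)"
  obtains A where "A > 0" "\<And>\<xi>. A \<le> alpha_symbol \<alpha> \<psi>_hat \<xi>"
proof -
  define c where "c = norm (\<psi>_hat v) / 2"
  have c: "c > 0" using nz by (simp add: c_def)
  obtain \<delta> where \<delta>: "\<delta> > 0" "\<And>u. dist u v < \<delta> \<Longrightarrow> dist (\<psi>_hat u) (\<psi>_hat v) < c"
    using cont c unfolding continuous_on_iff by (metis UNIV_I)
  have big: "c \<le> norm (\<psi>_hat u)" if "\<bar>u - v\<bar> < \<delta>" for u
  proof -
    have "norm (\<psi>_hat v - \<psi>_hat u) < c" using \<delta>(2)[of u] that by (simp add: dist_norm norm_minus_commute)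
    then show ?thesis using norm_triangle_ineq2[of "\<psi>_hat v" "\<psi>_hat u"] by (simp add: c_def)
  qed
  \<comment> \<open>The 4 keeps the deviation \<open>2 * \<eta> * (1 + \<bar>v\<bar>)\<close> at
    most \<open>\<delta> / 2\<close>, inside the neighbourhood where \<open>\<psi>_hat\<close> has
    modulus at least \<open>c\<close>; the cap 1/2 is required by
    \<open>alpha_scale_mult_close\<close>.\<close>
  define \<eta> where "\<eta> = min (1/2) (\<delta> / (4 * (1 + \<bar>v\<bar>)))"
  have "0 < \<eta>" using \<delta>(1) by (simp add: \<eta>_def add_pos_nonneg)
  moreover have "\<eta> \<le> 1/2" unfolding \<eta>_def by (rule min.cobounded1)
  ultimately have \<eta>: "0 < \<eta>" "\<eta> \<le> 1/2" .
  have "\<eta> \<le> \<delta> / (4 * (1 + \<bar>v\<bar>))" unfolding \<eta>_def by (rule min.cobounded2)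
  then have \<eta>\<delta>: "2 * \<eta> * (1 + \<bar>v\<bar>) < \<delta>"
    using \<delta>(1) by (simp add: field_simps add_pos_nonneg)
  have "c\<^sup>2 * \<eta> \<le> alpha_symbol \<alpha> \<psi>_hat \<xi>" for \<xi>
  proof -
    obtain \<omega>0 where \<omega>0: "alpha_scale \<alpha> \<omega>0 * (\<xi> - \<omega>0) = v" by (rule ex_alpha_scale_mult_eq[OF \<alpha>])
    let ?b = "alpha_scale \<alpha> \<omega>0"
    let ?J = "{\<omega>0 - \<eta> / ?b .. \<omega>0 + \<eta> / ?b}"
    have le: "?b / 2 * c\<^sup>2 * indicator ?J \<omega> \<le> (norm (atom_hat \<alpha> \<psi>_hat \<omega> \<xi>))\<^sup>2" for \<omega>
    proof (cases "\<omega> \<in> ?J")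
      case True
      then have cl: "\<bar>\<omega> - \<omega>0\<bar> \<le> \<eta> / ?b" by (auto simp: abs_le_iff)
      note near = alpha_scale_mult_close[OF \<alpha> \<eta> \<omega>0 cl]
      have "c \<le> norm (\<psi>_hat (alpha_scale \<alpha> \<omega> * (\<xi> - \<omega>)))"
        by (rule big) (use near(2) \<eta>\<delta> in linarith)
      then have "?b / 2 * c\<^sup>2 \<le> alpha_scale \<alpha> \<omega> * (norm (\<psi>_hat (alpha_scale \<alpha> \<omega> * (\<xi> - \<omega>))))\<^sup>2"
        using near(1) c by (intro mult_mono power_mono) (auto intro: less_imp_le)
      then show ?thesis using True by (simp add: norm_atom_hat_sq)
    qed simp
    have J: "integrable lborel (indicator ?J :: real \<Rightarrow> real)" "measure lborel ?J = 2 * \<eta> / ?b"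
      using \<eta> by (auto simp: less_imp_le emeasure_lborel_Icc_eq)
    have "c\<^sup>2 * \<eta> = ?b / 2 * c\<^sup>2 * measure lborel ?J" unfolding J(2) by simp
    also have "\<dots> = (LINT \<omega>|lborel. ?b / 2 * c\<^sup>2 * indicator ?J \<omega>)" by simp
    also have "\<dots> \<le> alpha_symbol \<alpha> \<psi>_hat \<xi>"
      unfolding alpha_symbol_def by (rule integral_mono[OF _ int le]) (use J(1) in simp)
    finally show ?thesis .
  qed
  moreover have "c\<^sup>2 * \<eta> > 0" using c \<eta> by simp
  ultimately show ?thesis using that by blast
qed

theorem theorem3p1:
  fixes \<alpha> r C :: real and \<psi> \<psi>_hat :: "real \<Rightarrow> complex"
  assumes "0 \<le> \<alpha>" and "\<alpha> < 1"
    and "\<psi> \<in> L2" and "\<not> (AE t in lborel. \<psi> t = 0)"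
    and "has_L2_fourier \<psi> \<psi>_hat"
    and "continuous_on UNIV \<psi>_hat"
    and "C > 0"
    and "\<And>\<xi>. norm (\<psi>_hat \<xi>) \<le> C * (1 + \<bar>\<xi>\<bar>) powr (- r)"
    and "r > max 1 (\<alpha> / (2 * (1 - \<alpha>)))"
  shows "admissible \<alpha> \<psi>"
proof -
  note \<alpha> = assms(1,2) and \<psi> = assms(5)
  have r: "r > 1" using assms(9) by simp
  have meas: "\<psi>_hat \<in> borel_measurable borel" by (rule L2_measurable[OF has_L2_fourierD(2)[OF \<psi>]])
  have bound: "norm (\<psi>_hat v) \<le> C" for v
  proof -
    \<comment> \<open>\<open>x powr 0\<close> is 1 only for nonzero \<open>x\<close>; at
      \<open>x = 0\<close> its value is 0.\<close>
    have "1 + \<bar>v\<bar> \<noteq> 0" using abs_ge_zero[of v] by linarith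
    then have "(1 + \<bar>v\<bar>) powr (- r) \<le> 1"
      using powr_mono[of "- r" 0 "1 + \<bar>v\<bar>"] r by simp
    then have "C * (1 + \<bar>v\<bar>) powr (- r) \<le> C * 1"
      using assms(7) by (intro mult_left_mono) auto
    then show ?thesis using assms(8)[of v] by simp
  qed
  \<comment> \<open>Injectivity of the transform: if \<open>\<psi>_hat\<close> vanished identically,
    \<psi> would agree almost everywhere with the zero function.\<close>
  have "\<exists>v. \<psi>_hat v \<noteq> 0"
  proof (rule ccontr)
    assume "\<nexists>v. \<psi>_hat v \<noteq> 0"
    moreover have "has_L2_fourier (\<lambda>t. 0) (\<lambda>\<xi>. 0)"
      using has_L2_fourier_cmult[OF \<psi>, of 0] by simp
    ultimately show False using has_L2_fourier_AE_eq_iff[OF \<psi>] assms(4) by simp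
  qed
  then obtain v where v: "\<psi>_hat v \<noteq> 0" ..
  have "2 * r > 1" using r by simp
  from alpha_symbol_upper[OF \<alpha> this meas assms(8)] obtain B where
    int: "\<And>\<xi>. integrable lborel (\<lambda>\<omega>. (norm (atom_hat \<alpha> \<psi>_hat \<omega> \<xi>))\<^sup>2)" and
    B: "\<And>\<xi>. alpha_symbol \<alpha> \<psi>_hat \<xi> \<le> B" by blast
  obtain A where A: "A > 0" "\<And>\<xi>. A \<le> alpha_symbol \<alpha> \<psi>_hat \<xi>"
    using alpha_symbol_lower[OF \<alpha> assms(6) v int] by blast
  let ?m = "alpha_symbol \<alpha> \<psi>_hat"
  have m: "?m \<in> borel_measurable borel" by (rule alpha_symbol_measurable[OF meas])
  have mb: "\<bar>?m \<xi>\<bar> \<le> B" for \<xi> using A(1) A(2)[of \<xi>] B[of \<xi>] by simp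
  show ?thesis
    unfolding admissible_def
  proof (intro exI conjI)
    show "weak_frame_operator \<alpha> \<psi> (fourier_multiplier ?m)"
      by (rule weak_frame_operator_fourier_multiplier[OF \<psi> bound int B])
    show "L2_bounded_operator (fourier_multiplier ?m)"
      by (rule L2_bounded_operator_fourier_multiplier[OF m mb])
    show "L2_boundedly_invertible (fourier_multiplier ?m)"
      by (rule L2_boundedly_invertible_fourier_multiplier[OF m A(2) B A(1)])
  qed
qed

end
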